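(* Let $G$ be a group, $A=\bigoplus_{g\in G}A_g$ an epsilon-strongly $G$-graded ring and $R=A_1$. The following assertions hold. (i) Let $g\in G$ and let $s_g\in A_g$ be such that there are $u_{g^{-1}},v_{g^{-1}}\in A_{g^{-1}}$ with $s_gu_{g^{-1}}=\epsilon_g$ and $v_{g^{-1}}s_g=\epsilon_{g^{-1}}$. Then $u_{g^{-1}}=v_{g^{-1}}$ and $s_g$ is epsilon-invertible. (ii) For each $g\in G$, the following statements are equivalent: (a) there exists an epsilon-invertible element in $A_g$; (b) there is a left $R$-module isomorphism between $A_g$ and $R\epsilon_g$; (c) there is a map $\theta:R\epsilon_{g^{-1}}\to R\epsilon_g$ in $I_u(R)$ and $A_g\simeq{}_{\mathrm{id}}(R\epsilon_g)_\theta$ as $R$-bimodules. (iii) Let $H(A)$ be the set of non-zero homogeneous elements of $A$. Then the following assertions are equivalent: (a) $A$ is an epsilon-crossed product; (b) there is a map $\kappa:G\to H(A)$ such that $\kappa(g)\in A_g$ and $R\kappa(g)=A_g=\kappa(g)R$ for all $g\in G$; (c) $\mathtt{Comp}(A)\subseteq\operatorname{im}\omega$; (d) there is a map $\nu:G\to I_u(R)$ such that $A_g\simeq{}_{\mathrm{id}}(R1_{\nu(g)})_{\nu(g)}$ as $R$-bimodules, for all $g\in G$.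
   Context: Rings are associative and unital; modules and bimodules are unital. For subsets $X,Y$ of a ring, $XY$ is the set of finite sums of products $xy$. A $G$-graded unital ring $A=\bigoplus_{g\in G}A_g$ (so $A_gA_h\subseteq A_{gh}$) is epsilon-strongly graded if for every $g\in G$ there is $\epsilon_g\in A_gA_{g^{-1}}$ with $\epsilon_ga=a=a\epsilon_{g^{-1}}$ for all $a\in A_g$; $\epsilon_g$ is unique, and is a central idempotent of $R=A_1$. An element $a_g\in A_g$ is epsilon-invertible if there is $b_{g^{-1}}\in A_{g^{-1}}$ with $a_gb_{g^{-1}}=\epsilon_g$ and $b_{g^{-1}}a_g=\epsilon_{g^{-1}}$. $A$ is an epsilon-crossed product if every $A_g$, $g\in G$, contains an epsilon-invertible element. $I_u(R)$ is the set of ring isomorphisms $\theta:R1_{\theta^{-1}}\to R1_\theta$ between unital ideals of $R$, where $1_{\theta^{-1}},1_\theta$ are the central idempotents of $R$ generating the domain and the image. For $\theta\in I_u(R)$, ${}_{\mathrm{id}}(R1_\theta)_\theta$ is the $R$-bimodule $R1_\theta$ with its usual left action and right action $m\cdot a=m\,\theta(a1_{\theta^{-1}})$. $\mathtt{PicS}(R)$ is the set of isomorphism classes $[P]$ of partially invertible $R$-bimodules $P$, i.e. those that are finitely generated projective as left and as right $R$-modules and for which $l:R\to\operatorname{End}(P_R)$, $l(a)(x)=ax$, and $r:R\to\operatorname{End}({}_RP)$, $r(a)(x)=xa$, are epimorphisms of $R$-bimodules. One has $[A_g]\in\mathtt{PicS}(R)$ for all $g$; put $\mathtt{Comp}(A)=\{[A_g]:g\in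 G\}\subseteq\mathtt{PicS}(R)$. The map $\omega:I_u(R)\to\mathtt{PicS}(R)$ is $\omega(\theta)=[{}_{\mathrm{id}}(R1_\theta)_\theta]$.
   Formalization: In (iii)(b), κ(g) is required to be a non-zero homogeneous element only for those g with A_g ≠ 0; where A_g = 0, κ(g) = 0 is allowed, since otherwise (a) ⇒ (b) fails, e.g. for A = R concentrated in degree 1 of a nontrivial group. *)

theory Defs
  imports "HOL-Algebra.Module" "HOL-Algebra.Subrings" "HOL-Algebra.Ideal_Product" "HOL-Algebra.QuotRing"
begin

section \<open>Epsilon-strongly graded rings\<close>

text \<open>
  A grading of \<open>A\<close> is a family of additive subgroups \<open>gr g\<close>. For additive subgroups \<open>X\<close> and \<open>Y\<close>,
  or \<open>Y\<close> a single element and \<open>X\<close> an additive subgroup (or vice versa), the library's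
  \<open>X \<cdot>\<^bsub>A\<^esub> Y\<close> is the set of all finite sums of products \<open>x \<otimes> y\<close>; that it is only built from nonempty
  sums makes no difference, as \<open>\<zero>\<close> is itself such a product.
\<close>

locale graded_ring = G: group G + A: ring A
  for G :: "('g, 'm) monoid_scheme" and A :: "('a, 'n) ring_scheme" +
  fixes gr :: "'g \<Rightarrow> 'a set"
  assumes gr_subgroup: "g \<in> carrier G \<Longrightarrow> additive_subgroup (gr g) A"
    and gr_direct_sum: "a \<in> carrier A \<Longrightarrow>
      \<exists>!x. x \<in> Pi\<^sub>E (carrier G) gr \<and> finite {g \<in> carrier G. x g \<noteq> \<zero>\<^bsub>A\<^esub>} \<and>
           a = (\<Oplus>\<^bsub>A\<^esub>g\<in>{g \<in> carrier G. x g \<noteq> \<zero>\<^bsub>A\<^esub>}. x g)"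
    and gr_mult: "\<lbrakk>g \<in> carrier G; h \<in> carrier G; a \<in> gr g; b \<in> gr h\<rbrakk> \<Longrightarrow>
      a \<otimes>\<^bsub>A\<^esub> b \<in> gr (g \<otimes>\<^bsub>G\<^esub> h)"

locale epsilon_strongly_graded_ring = graded_ring +
  assumes ex_epsilon:
    "\<exists>\<epsilon>. \<forall>g \<in> carrier G. \<epsilon> g \<in> gr g \<cdot>\<^bsub>A\<^esub> gr (inv\<^bsub>G\<^esub> g) \<and>
       (\<forall>a \<in> gr g. \<epsilon> g \<otimes>\<^bsub>A\<^esub> a = a \<and> a \<otimes>\<^bsub>A\<^esub> \<epsilon> (inv\<^bsub>G\<^esub> g) = a)"

text \<open>
  The two conditions on \<open>\<epsilon> g\<close> are those of \<open>ex_epsilon\<close> at \<open>g\<close> and at \<open>inv g\<close> that mention \<open>\<epsilon> g\<close>;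
  see \<open>epsilon_eqI\<close>, \<open>epsilon_prod\<close>, \<open>epsilon_left\<close>, \<open>epsilon_right\<close> below.
\<close>

definition epsilon :: "('g, 'm) monoid_scheme \<Rightarrow> ('a, 'n) ring_scheme \<Rightarrow> ('g \<Rightarrow> 'a set) \<Rightarrow> 'g \<Rightarrow> 'a"
  where "epsilon G A gr g = (THE e. e \<in> gr g \<cdot>\<^bsub>A\<^esub> gr (inv\<^bsub>G\<^esub> g) \<and>
    (\<forall>a \<in> gr g. e \<otimes>\<^bsub>A\<^esub> a = a) \<and> (\<forall>a \<in> gr (inv\<^bsub>G\<^esub> g). a \<otimes>\<^bsub>A\<^esub> e = a))"

definition epsilon_invertible ::
    "('g, 'm) monoid_scheme \<Rightarrow> ('a, 'n) ring_scheme \<Rightarrow> ('g \<Rightarrow> 'a set) \<Rightarrow> 'g \<Rightarrow> 'a \<Rightarrow> bool"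
  where "epsilon_invertible G A gr g a \<longleftrightarrow> a \<in> gr g \<and>
    (\<exists>b \<in> gr (inv\<^bsub>G\<^esub> g). a \<otimes>\<^bsub>A\<^esub> b = epsilon G A gr g \<and> b \<otimes>\<^bsub>A\<^esub> a = epsilon G A gr (inv\<^bsub>G\<^esub> g))"

definition epsilon_crossed_product ::
    "('g, 'm) monoid_scheme \<Rightarrow> ('a, 'n) ring_scheme \<Rightarrow> ('g \<Rightarrow> 'a set) \<Rightarrow> bool"
  where "epsilon_crossed_product G A gr \<longleftrightarrow>
    (\<forall>g \<in> carrier G. \<exists>a \<in> gr g. epsilon_invertible G A gr g a)"

text \<open>
  Components \<open>gr g\<close> may be zero (for instance all but one in a trivially graded ring), and then contain
  no element of the following set: a choice of \<open>\<kappa> g \<in> gr g\<close> for all \<open>g\<close> can be asked to lie in it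
  only where \<open>gr g\<close> is nonzero.
\<close>

definition nonzero_homogeneous ::
    "('g, 'm) monoid_scheme \<Rightarrow> ('a, 'n) ring_scheme \<Rightarrow> ('g \<Rightarrow> 'a set) \<Rightarrow> 'a set"
  where "nonzero_homogeneous G A gr = (\<Union>g \<in> carrier G. gr g) - {\<zero>\<^bsub>A\<^esub>}"

definition principal_component ::
    "('g, 'm) monoid_scheme \<Rightarrow> ('a, 'n) ring_scheme \<Rightarrow> ('g \<Rightarrow> 'a set) \<Rightarrow> ('a, 'n) ring_scheme"
  where "principal_component G A gr = A\<lparr>carrier := gr \<one>\<^bsub>G\<^esub>\<rparr>"


section \<open>Bimodules\<close>

text \<open>As in the library's \<open>module\<close> record, the inherited fields \<open>mult\<close> and \<open>one\<close> carry no meaning.\<close>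

record ('a, 'p) bimod = "('a, 'p) module" +
  rsmult :: "'p \<Rightarrow> 'a \<Rightarrow> 'p"  (infixl \<open>\<odot>\<^sub>r\<index>\<close> 70)

locale bimodule = R: ring R + P: abelian_group P
  for R :: "('a, 'n) ring_scheme" and P :: "('a, 'p, 'x) bimod_scheme" +
  assumes lsmult_closed: "\<lbrakk>a \<in> carrier R; x \<in> carrier P\<rbrakk> \<Longrightarrow> a \<odot>\<^bsub>P\<^esub> x \<in> carrier P"
    and lsmult_l_distr: "\<lbrakk>a \<in> carrier R; b \<in> carrier R; x \<in> carrier P\<rbrakk> \<Longrightarrow>
      (a \<oplus>\<^bsub>R\<^esub> b) \<odot>\<^bsub>P\<^esub> x = a \<odot>\<^bsub>P\<^esub> x \<oplus>\<^bsub>P\<^esub> b \<odot>\<^bsub>P\<^esub> x"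
    and lsmult_r_distr: "\<lbrakk>a \<in> carrier R; x \<in> carrier P; y \<in> carrier P\<rbrakk> \<Longrightarrow>
      a \<odot>\<^bsub>P\<^esub> (x \<oplus>\<^bsub>P\<^esub> y) = a \<odot>\<^bsub>P\<^esub> x \<oplus>\<^bsub>P\<^esub> a \<odot>\<^bsub>P\<^esub> y"
    and lsmult_assoc: "\<lbrakk>a \<in> carrier R; b \<in> carrier R; x \<in> carrier P\<rbrakk> \<Longrightarrow>
      (a \<otimes>\<^bsub>R\<^esub> b) \<odot>\<^bsub>P\<^esub> x = a \<odot>\<^bsub>P\<^esub> (b \<odot>\<^bsub>P\<^esub> x)"
    and lsmult_one: "x \<in> carrier P \<Longrightarrow> \<one>\<^bsub>R\<^esub> \<odot>\<^bsub>P\<^esub> x = x"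
    and rsmult_closed: "\<lbrakk>a \<in> carrier R; x \<in> carrier P\<rbrakk> \<Longrightarrow> x \<odot>\<^sub>r\<^bsub>P\<^esub> a \<in> carrier P"
    and rsmult_r_distr: "\<lbrakk>a \<in> carrier R; b \<in> carrier R; x \<in> carrier P\<rbrakk> \<Longrightarrow>
      x \<odot>\<^sub>r\<^bsub>P\<^esub> (a \<oplus>\<^bsub>R\<^esub> b) = x \<odot>\<^sub>r\<^bsub>P\<^esub> a \<oplus>\<^bsub>P\<^esub> x \<odot>\<^sub>r\<^bsub>P\<^esub> b"
    and rsmult_l_distr: "\<lbrakk>a \<in> carrier R; x \<in> carrier P; y \<in> carrier P\<rbrakk> \<Longrightarrow>
      (x \<oplus>\<^bsub>P\<^esub> y) \<odot>\<^sub>r\<^bsub>P\<^esub> a = x \<odot>\<^sub>r\<^bsub>P\<^esub> a \<oplus>\<^bsub>P\<^esub> y \<odot>\<^sub>r\<^bsub>P\<^esub> a"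
    and rsmult_assoc: "\<lbrakk>a \<in> carrier R; b \<in> carrier R; x \<in> carrier P\<rbrakk> \<Longrightarrow>
      x \<odot>\<^sub>r\<^bsub>P\<^esub> (a \<otimes>\<^bsub>R\<^esub> b) = (x \<odot>\<^sub>r\<^bsub>P\<^esub> a) \<odot>\<^sub>r\<^bsub>P\<^esub> b"
    and rsmult_one: "x \<in> carrier P \<Longrightarrow> x \<odot>\<^sub>r\<^bsub>P\<^esub> \<one>\<^bsub>R\<^esub> = x"
    and lsmult_rsmult: "\<lbrakk>a \<in> carrier R; b \<in> carrier R; x \<in> carrier P\<rbrakk> \<Longrightarrow>
      (a \<odot>\<^bsub>P\<^esub> x) \<odot>\<^sub>r\<^bsub>P\<^esub> b = a \<odot>\<^bsub>P\<^esub> (x \<odot>\<^sub>r\<^bsub>P\<^esub> b)"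

definition left_hom ::
    "('a, 'n) ring_scheme \<Rightarrow> ('a, 'p, 'x) bimod_scheme \<Rightarrow> ('a, 'q, 'y) bimod_scheme \<Rightarrow> ('p \<Rightarrow> 'q) set"
  where "left_hom R P Q = {f \<in> carrier P \<rightarrow> carrier Q.
    (\<forall>x \<in> carrier P. \<forall>y \<in> carrier P. f (x \<oplus>\<^bsub>P\<^esub> y) = f x \<oplus>\<^bsub>Q\<^esub> f y) \<and>
    (\<forall>a \<in> carrier R. \<forall>x \<in> carrier P. f (a \<odot>\<^bsub>P\<^esub> x) = a \<odot>\<^bsub>Q\<^esub> f x)}"

definition right_hom ::
    "('a, 'n) ring_scheme \<Rightarrow> ('a, 'p, 'x) bimod_scheme \<Rightarrow> ('a, 'q, 'y) bimod_scheme \<Rightarrow> ('p \<Rightarrow> 'q) set"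
  where "right_hom R P Q = {f \<in> carrier P \<rightarrow> carrier Q.
    (\<forall>x \<in> carrier P. \<forall>y \<in> carrier P. f (x \<oplus>\<^bsub>P\<^esub> y) = f x \<oplus>\<^bsub>Q\<^esub> f y) \<and>
    (\<forall>a \<in> carrier R. \<forall>x \<in> carrier P. f (x \<odot>\<^sub>r\<^bsub>P\<^esub> a) = f x \<odot>\<^sub>r\<^bsub>Q\<^esub> a)}"

definition left_isomorphic ::
    "('a, 'n) ring_scheme \<Rightarrow> ('a, 'p, 'x) bimod_scheme \<Rightarrow> ('a, 'q, 'y) bimod_scheme \<Rightarrow> bool"
  where "left_isomorphic R P Q \<longleftrightarrow>
    (\<exists>f \<in> left_hom R P Q. bij_betw f (carrier P) (carrier Q))"

definition bimod_isomorphic ::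
    "('a, 'n) ring_scheme \<Rightarrow> ('a, 'p, 'x) bimod_scheme \<Rightarrow> ('a, 'q, 'y) bimod_scheme \<Rightarrow> bool"
  where "bimod_isomorphic R P Q \<longleftrightarrow>
    (\<exists>f \<in> left_hom R P Q \<inter> right_hom R P Q. bij_betw f (carrier P) (carrier Q))"

text \<open>A subset \<open>S\<close> of \<open>A\<close>, acted upon from both sides by multiplication in \<open>A\<close>.\<close>

definition sub_bimod :: "('a, 'n) ring_scheme \<Rightarrow> 'a set \<Rightarrow> ('a, 'a) bimod"
  where "sub_bimod A S = \<lparr>carrier = S, mult = mult A, one = one A, zero = zero A, add = add A,
    smult = mult A, rsmult = mult A\<rparr>"

definition free_bimod :: "('a, 'n) ring_scheme \<Rightarrow> nat \<Rightarrow> ('a, nat \<Rightarrow> 'a) bimod"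
  where "free_bimod R n = \<lparr>carrier = {..<n} \<rightarrow>\<^sub>E carrier R,
    mult = (\<lambda>x y. \<lambda>i\<in>{..<n}. x i \<otimes>\<^bsub>R\<^esub> y i), one = (\<lambda>i\<in>{..<n}. \<one>\<^bsub>R\<^esub>),
    zero = (\<lambda>i\<in>{..<n}. \<zero>\<^bsub>R\<^esub>), add = (\<lambda>x y. \<lambda>i\<in>{..<n}. x i \<oplus>\<^bsub>R\<^esub> y i),
    smult = (\<lambda>a x. \<lambda>i\<in>{..<n}. a \<otimes>\<^bsub>R\<^esub> x i), rsmult = (\<lambda>x a. \<lambda>i\<in>{..<n}. x i \<otimes>\<^bsub>R\<^esub> a)\<rparr>"

text \<open>Finitely generated projective: a direct summand of a free module of finite rank.\<close>

definition left_fg_projective :: "('a, 'n) ring_scheme \<Rightarrow> ('a, 'p, 'x) bimod_scheme \<Rightarrow> bool"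
  where "left_fg_projective R P \<longleftrightarrow> (\<exists>n. \<exists>i \<in> left_hom R P (free_bimod R n).
    \<exists>p \<in> left_hom R (free_bimod R n) P. \<forall>x \<in> carrier P. p (i x) = x)"

definition right_fg_projective :: "('a, 'n) ring_scheme \<Rightarrow> ('a, 'p, 'x) bimod_scheme \<Rightarrow> bool"
  where "right_fg_projective R P \<longleftrightarrow> (\<exists>n. \<exists>i \<in> right_hom R P (free_bimod R n).
    \<exists>p \<in> right_hom R (free_bimod R n) P. \<forall>x \<in> carrier P. p (i x) = x)"

text \<open>The last two conditions say that the bimodule maps \<open>l\<close> and \<open>r\<close> are surjective, which is the
  same as being epimorphisms.\<close>

definition partially_invertible :: "('a, 'n) ring_scheme \<Rightarrow> ('a, 'p, 'x) bimod_scheme \<Rightarrow> bool"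
  where "partially_invertible R P \<longleftrightarrow> bimodule R P \<and>
    left_fg_projective R P \<and> right_fg_projective R P \<and>
    (\<forall>f \<in> right_hom R P P. \<exists>a \<in> carrier R. \<forall>x \<in> carrier P. f x = a \<odot>\<^bsub>P\<^esub> x) \<and>
    (\<forall>f \<in> left_hom R P P. \<exists>a \<in> carrier R. \<forall>x \<in> carrier P. f x = x \<odot>\<^sub>r\<^bsub>P\<^esub> a)"

text \<open>
  Isomorphism classes have to be taken within one type. Bimodules with carrier in \<open>nat \<Rightarrow> 'a\<close>
  suffice: every bimodule that is finitely generated projective on one side embeds as a set into
  some \<open>R\<^sup>n\<close>, hence is isomorphic to one of those. The bimodule \<open>P\<close> itself may live in any type.
\<close>

definition bimod_class ::
    "('a, 'n) ring_scheme \<Rightarrow> ('a, 'p, 'x) bimod_scheme \<Rightarrow> ('a, nat \<Rightarrow> 'a) bimod set"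
  where "bimod_class R P = {Q. bimodule R Q \<and> bimod_isomorphic R P Q}"

definition PicS :: "('a, 'n) ring_scheme \<Rightarrow> ('a, nat \<Rightarrow> 'a) bimod set set"
  where "PicS R = {bimod_class R P | P :: ('a, nat \<Rightarrow> 'a) bimod. partially_invertible R P}"

definition Comp ::
    "('g, 'm) monoid_scheme \<Rightarrow> ('a, 'n) ring_scheme \<Rightarrow> ('g \<Rightarrow> 'a set) \<Rightarrow> ('a, nat \<Rightarrow> 'a) bimod set set"
  where "Comp G A gr =
    {bimod_class (principal_component G A gr) (sub_bimod A (gr g)) | g. g \<in> carrier G}"


section \<open>Isomorphisms between unital ideals\<close>

definition central_idempotents :: "('a, 'n) ring_scheme \<Rightarrow> 'a set"
  where "central_idempotents R =
    {e \<in> carrier R. e \<otimes>\<^bsub>R\<^esub> e = e \<and> (\<forall>x \<in> carrier R. e \<otimes>\<^bsub>R\<^esub> x = x \<otimes>\<^bsub>R\<^esub> e)}"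

text \<open>\<open>PIdl\<^bsub>R\<^esub> e\<close> is the library's notation for the set of all \<open>x \<otimes>\<^bsub>R\<^esub> e\<close> with \<open>x \<in> carrier R\<close>.\<close>

definition unital_ideal :: "('a, 'n) ring_scheme \<Rightarrow> 'a \<Rightarrow> ('a, 'n) ring_scheme"
  where "unital_ideal R e = R\<lparr>carrier := PIdl\<^bsub>R\<^esub> e, one := e\<rparr>"

text \<open>An isomorphism \<open>\<theta>\<close> is given by its underlying map together with the idempotents
  \<open>dom_one \<theta> = 1\<^bsub>\<theta>\<inverse>\<^esub>\<close> and \<open>im_one \<theta> = 1\<^bsub>\<theta>\<^esub>\<close>.\<close>

record 'a ideal_iso =
  dom_one :: 'a
  im_one :: 'a
  iso_map :: "'a \<Rightarrow> 'a"

definition I_u :: "('a, 'n) ring_scheme \<Rightarrow> 'a ideal_iso set"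
  where "I_u R = {\<theta>. dom_one \<theta> \<in> central_idempotents R \<and> im_one \<theta> \<in> central_idempotents R \<and>
    iso_map \<theta> \<in> ring_iso (unital_ideal R (dom_one \<theta>)) (unital_ideal R (im_one \<theta>)) \<and>
    iso_map \<theta> \<in> extensional (PIdl\<^bsub>R\<^esub> (dom_one \<theta>))}"

definition twisted_bimod :: "('a, 'n) ring_scheme \<Rightarrow> 'a ideal_iso \<Rightarrow> ('a, 'a) bimod"
  where "twisted_bimod R \<theta> = (sub_bimod R (PIdl\<^bsub>R\<^esub> (im_one \<theta>)))
    \<lparr>rsmult := (\<lambda>m a. m \<otimes>\<^bsub>R\<^esub> iso_map \<theta> (a \<otimes>\<^bsub>R\<^esub> dom_one \<theta>))\<rparr>"

definition omega :: "('a, 'n) ring_scheme \<Rightarrow> 'a ideal_iso \<Rightarrow> ('a, nat \<Rightarrow> 'a) bimod set"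
  where "omega R \<theta> = bimod_class R (twisted_bimod R \<theta>)"


section \<open>The idempotents and the components of the grading\<close>

context graded_ring begin

lemma gr_carrier: "g \<in> carrier G \<Longrightarrow> a \<in> gr g \<Longrightarrow> a \<in> carrier A"
  using gr_subgroup additive_subgroup.a_Hcarr by metis

lemma gr_prod_one:
  assumes "g \<in> carrier G" "z \<in> gr g \<cdot>\<^bsub>A\<^esub> gr (inv\<^bsub>G\<^esub> g)"
  shows "z \<in> gr \<one>\<^bsub>G\<^esub>"
  using assms(2)
proof induction
  case (prod i j) then show ?case using gr_mult[of g "inv\<^bsub>G\<^esub> g" i j] assms(1) by simp
next
  case (sum s1 s2) then show ?case
    by (meson G.one_closed additive_subgroup.a_closed gr_subgroup)
qed

lemma gr_left_unit_ext:
  assumes e: "e \<in> carrier A" and h: "\<And>g a. g \<in> carrier G \<Longrightarrow> a \<in> gr g \<Longrightarrow> e \<otimes>\<^bsub>A\<^esub> a = a"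
    and a: "a \<in> carrier A"
  shows "e \<otimes>\<^bsub>A\<^esub> a = a"
proof -
  obtain x where x: "x \<in> Pi\<^sub>E (carrier G) gr" "finite {g \<in> carrier G. x g \<noteq> \<zero>\<^bsub>A\<^esub>}"
    "a = (\<Oplus>\<^bsub>A\<^esub>g\<in>{g \<in> carrier G. x g \<noteq> \<zero>\<^bsub>A\<^esub>}. x g)"
    using gr_direct_sum[OF a] by (elim ex1E conjE) (rule that)
  let ?S = "{g \<in> carrier G. x g \<noteq> \<zero>\<^bsub>A\<^esub>}"
  have xg: "x g \<in> gr g" if "g \<in> carrier G" for g using x(1) that by auto
  then have xc: "x \<in> ?S \<rightarrow> carrier A" using gr_carrier by auto
  have "e \<otimes>\<^bsub>A\<^esub> a = (\<Oplus>\<^bsub>A\<^esub>g\<in>?S. e \<otimes>\<^bsub>A\<^esub> x g)"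
    unfolding x(3) by (rule A.finsum_rdistr[OF x(2) e xc])
  also have "\<dots> = (\<Oplus>\<^bsub>A\<^esub>g\<in>?S. x g)"
    by (rule A.finsum_cong') (use xc xg h in auto)
  finally show ?thesis using x(3) by simp
qed

end

context epsilon_strongly_graded_ring begin

abbreviation "R \<equiv> principal_component G A gr"
abbreviation "eps \<equiv> epsilon G A gr"

lemma gr_prod_left_unit:
  assumes g: "g \<in> carrier G" "h \<in> carrier G" and e: "e \<in> carrier A" "\<And>a. a \<in> gr g \<Longrightarrow> e \<otimes>\<^bsub>A\<^esub> a = a"
    and z: "z \<in> gr g \<cdot>\<^bsub>A\<^esub> gr h"
  shows "z \<in> carrier A \<and> e \<otimes>\<^bsub>A\<^esub> z = z"
  using z
proof induction
  case (prod i j) then show ?case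
    using g gr_carrier e by (metis A.m_assoc A.m_closed)
next
  case (sum s1 s2) then show ?case using e by (simp add: A.r_distr)
qed

lemma gr_prod_right_unit:
  assumes g: "g \<in> carrier G" "h \<in> carrier G" and e: "e \<in> carrier A" "\<And>a. a \<in> gr h \<Longrightarrow> a \<otimes>\<^bsub>A\<^esub> e = a"
    and z: "z \<in> gr g \<cdot>\<^bsub>A\<^esub> gr h"
  shows "z \<in> carrier A \<and> z \<otimes>\<^bsub>A\<^esub> e = z"
  using z
proof induction
  case (prod i j) then show ?case
    using g gr_carrier e by (metis A.m_assoc A.m_closed)
next
  case (sum s1 s2) then show ?case using e by (simp add: A.l_distr)
qed

lemma epsilon_unique:
  assumes g: "g \<in> carrier G"
    and e: "e \<in> gr g \<cdot>\<^bsub>A\<^esub> gr (inv\<^bsub>G\<^esub> g)" "\<And>a. a \<in> gr g \<Longrightarrow> e \<otimes>\<^bsub>A\<^esub> a = a"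
    and f: "f \<in> gr g \<cdot>\<^bsub>A\<^esub> gr (inv\<^bsub>G\<^esub> g)" "\<And>a. a \<in> gr (inv\<^bsub>G\<^esub> g) \<Longrightarrow> a \<otimes>\<^bsub>A\<^esub> f = a"
  shows "e = f"
proof -
  have c: "e \<in> carrier A" "f \<in> carrier A"
    using gr_prod_one[OF g] gr_carrier e f by blast+
  have "e \<otimes>\<^bsub>A\<^esub> f = f" using gr_prod_left_unit[OF g _ c(1) e(2) f(1)] g by simp
  moreover have "e \<otimes>\<^bsub>A\<^esub> f = e" using gr_prod_right_unit[OF g _ c(2) f(2) e(1)] g by simp
  ultimately show ?thesis by simp
qed

lemma epsilon_eqI:
  assumes g: "g \<in> carrier G"
    and e: "e \<in> gr g \<cdot>\<^bsub>A\<^esub> gr (inv\<^bsub>G\<^esub> g)" "\<And>a. a \<in> gr g \<Longrightarrow> e \<otimes>\<^bsub>A\<^esub> a = a"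
      "\<And>a. a \<in> gr (inv\<^bsub>G\<^esub> g) \<Longrightarrow> a \<otimes>\<^bsub>A\<^esub> e = a"
  shows "eps g = e"
  unfolding epsilon_def
proof (rule the_equality)
  show "e \<in> gr g \<cdot>\<^bsub>A\<^esub> gr (inv\<^bsub>G\<^esub> g) \<and> (\<forall>a\<in>gr g. e \<otimes>\<^bsub>A\<^esub> a = a) \<and> (\<forall>a\<in>gr (inv\<^bsub>G\<^esub> g). a \<otimes>\<^bsub>A\<^esub> e = a)"
    using e by blast
qed (metis g e epsilon_unique)

lemma
  assumes g: "g \<in> carrier G"
  shows epsilon_prod: "eps g \<in> gr g \<cdot>\<^bsub>A\<^esub> gr (inv\<^bsub>G\<^esub> g)"
    and epsilon_left: "a \<in> gr g \<Longrightarrow> eps g \<otimes>\<^bsub>A\<^esub> a = a"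
    and epsilon_right: "a \<in> gr g \<Longrightarrow> a \<otimes>\<^bsub>A\<^esub> eps (inv\<^bsub>G\<^esub> g) = a"
proof -
  obtain E where E: "\<And>g. g \<in> carrier G \<Longrightarrow> E g \<in> gr g \<cdot>\<^bsub>A\<^esub> gr (inv\<^bsub>G\<^esub> g)"
    "\<And>g a. g \<in> carrier G \<Longrightarrow> a \<in> gr g \<Longrightarrow> E g \<otimes>\<^bsub>A\<^esub> a = a"
    "\<And>g a. g \<in> carrier G \<Longrightarrow> a \<in> gr g \<Longrightarrow> a \<otimes>\<^bsub>A\<^esub> E (inv\<^bsub>G\<^esub> g) = a"
    using ex_epsilon by metis
  have eq: "eps h = E h" if h: "h \<in> carrier G" for h
    using E(3)[of "inv\<^bsub>G\<^esub> h"] h by (intro epsilon_eqI[OF h]) (auto simp: E)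
  show "eps g \<in> gr g \<cdot>\<^bsub>A\<^esub> gr (inv\<^bsub>G\<^esub> g)" using E(1) eq g by simp
  show "eps g \<otimes>\<^bsub>A\<^esub> a = a" if "a \<in> gr g" using E(2) eq g that by simp
  show "a \<otimes>\<^bsub>A\<^esub> eps (inv\<^bsub>G\<^esub> g) = a" if "a \<in> gr g" using E(3) eq[of "inv\<^bsub>G\<^esub> g"] g that by simp
qed

lemma epsilon_gr_one: "g \<in> carrier G \<Longrightarrow> eps g \<in> gr \<one>\<^bsub>G\<^esub>"
  by (meson epsilon_prod gr_prod_one)

lemma epsilon_one: "eps \<one>\<^bsub>G\<^esub> = \<one>\<^bsub>A\<^esub>"
proof -
  let ?e = "eps \<one>\<^bsub>G\<^esub>"
  have e: "?e \<in> carrier A" using epsilon_gr_one[of "\<one>\<^bsub>G\<^esub>"] gr_carrier[of "\<one>\<^bsub>G\<^esub>"] by simp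
  have "?e \<otimes>\<^bsub>A\<^esub> a = a" if g: "g \<in> carrier G" and a: "a \<in> gr g" for g a
  proof -
    have c: "eps g \<in> carrier A" "a \<in> carrier A"
      using epsilon_gr_one[OF g] gr_carrier a g by auto
    have "?e \<otimes>\<^bsub>A\<^esub> a = ?e \<otimes>\<^bsub>A\<^esub> (eps g \<otimes>\<^bsub>A\<^esub> a)" using epsilon_left[OF g a] by simp
    also have "\<dots> = (?e \<otimes>\<^bsub>A\<^esub> eps g) \<otimes>\<^bsub>A\<^esub> a" using c e by (simp add: A.m_assoc)
    also have "?e \<otimes>\<^bsub>A\<^esub> eps g = eps g" using epsilon_left[OF _ epsilon_gr_one[OF g]] by simp
    finally show ?thesis using epsilon_left[OF g a] by simp
  qed
  then have "?e \<otimes>\<^bsub>A\<^esub> \<one>\<^bsub>A\<^esub> = \<one>\<^bsub>A\<^esub>" by (rule gr_left_unit_ext[OF e]) auto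
  then show ?thesis using e by simp
qed

lemma one_gr: "\<one>\<^bsub>A\<^esub> \<in> gr \<one>\<^bsub>G\<^esub>"
  using epsilon_gr_one[of "\<one>\<^bsub>G\<^esub>"] epsilon_one by simp

lemma ring_principal_component: "ring R"
proof -
  interpret S: additive_subgroup "gr \<one>\<^bsub>G\<^esub>" A by (rule gr_subgroup) simp
  have "subring (gr \<one>\<^bsub>G\<^esub>) A"
  proof (rule A.subringI)
    show "h1 \<otimes>\<^bsub>A\<^esub> h2 \<in> gr \<one>\<^bsub>G\<^esub>" if "h1 \<in> gr \<one>\<^bsub>G\<^esub>" "h2 \<in> gr \<one>\<^bsub>G\<^esub>" for h1 h2
      using gr_mult[OF _ _ that] by simp
  qed (use one_gr S.a_subset S.a_inv_closed in \<open>auto\<close>)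
  then show ?thesis unfolding principal_component_def by (rule A.subring_is_ring)
qed

lemma gr_bimodule: 
  assumes g: "g \<in> carrier G"
  shows "bimodule R (sub_bimod A (gr g))"
proof -
  interpret S: additive_subgroup "gr g" A by (rule gr_subgroup) fact
  have 1: "a \<in> carrier A" if "a \<in> gr \<one>\<^bsub>G\<^esub>" for a using that gr_carrier[of "\<one>\<^bsub>G\<^esub>"] by simp
  have m: "a \<otimes>\<^bsub>A\<^esub> b \<in> gr g" if "a \<in> gr \<one>\<^bsub>G\<^esub>" "b \<in> gr g" for a b
    using gr_mult[of "\<one>\<^bsub>G\<^esub>" g a b] that g by simp
  have m': "b \<otimes>\<^bsub>A\<^esub> a \<in> gr g" if "a \<in> gr \<one>\<^bsub>G\<^esub>" "b \<in> gr g" for a b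
    using gr_mult[of g "\<one>\<^bsub>G\<^esub>" b a] that g by simp
  have "abelian_group (sub_bimod A (gr g))"
  proof (rule abelian_groupI)
    show "\<exists>y\<in>carrier (sub_bimod A (gr g)). y \<oplus>\<^bsub>sub_bimod A (gr g)\<^esub> x = \<zero>\<^bsub>sub_bimod A (gr g)\<^esub>"
      if "x \<in> carrier (sub_bimod A (gr g))" for x
      using that S.a_inv_closed[of x] A.l_neg[of x]
      by (intro bexI[of _ "\<ominus>\<^bsub>A\<^esub> x"]) (auto simp: sub_bimod_def)
    show "x \<oplus>\<^bsub>sub_bimod A (gr g)\<^esub> y = y \<oplus>\<^bsub>sub_bimod A (gr g)\<^esub> x"
      if "x \<in> carrier (sub_bimod A (gr g))" "y \<in> carrier (sub_bimod A (gr g))" for x y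
      using that A.a_comm by (auto simp: sub_bimod_def)
  qed (auto simp: sub_bimod_def A.a_assoc S.zero_closed)
  then show ?thesis
    by (intro bimodule.intro bimodule_axioms.intro ring_principal_component)
      (auto simp: sub_bimod_def principal_component_def 1 m m' A.l_distr A.r_distr A.m_assoc)
qed

end


section \<open>Isomorphism invariance of partial invertibility\<close>

lemma left_homD:
  assumes "f \<in> left_hom R P Q"
  shows "x \<in> carrier P \<Longrightarrow> f x \<in> carrier Q"
    and "x \<in> carrier P \<Longrightarrow> y \<in> carrier P \<Longrightarrow> f (x \<oplus>\<^bsub>P\<^esub> y) = f x \<oplus>\<^bsub>Q\<^esub> f y"
    and "a \<in> carrier R \<Longrightarrow> x \<in> carrier P \<Longrightarrow> f (a \<odot>\<^bsub>P\<^esub> x) = a \<odot>\<^bsub>Q\<^esub> f x"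
  using assms by (auto simp: left_hom_def)

lemma right_homD:
  assumes "f \<in> right_hom R P Q"
  shows "x \<in> carrier P \<Longrightarrow> f x \<in> carrier Q"
    and "x \<in> carrier P \<Longrightarrow> y \<in> carrier P \<Longrightarrow> f (x \<oplus>\<^bsub>P\<^esub> y) = f x \<oplus>\<^bsub>Q\<^esub> f y"
    and "a \<in> carrier R \<Longrightarrow> x \<in> carrier P \<Longrightarrow> f (x \<odot>\<^sub>r\<^bsub>P\<^esub> a) = f x \<odot>\<^sub>r\<^bsub>Q\<^esub> a"
  using assms by (auto simp: right_hom_def)

lemma left_hom_comp:
  "f \<in> left_hom R P Q \<Longrightarrow> g \<in> left_hom R Q S \<Longrightarrow> g \<circ> f \<in> left_hom R P S"
  by (auto simp: left_hom_def Pi_iff)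

lemma right_hom_comp:
  "f \<in> right_hom R P Q \<Longrightarrow> g \<in> right_hom R Q S \<Longrightarrow> g \<circ> f \<in> right_hom R P S"
  by (auto simp: right_hom_def Pi_iff)

context bimodule begin

lemma bij_inverse_hom:
  assumes b: "bij_betw f (carrier P) (carrier Q)"
  shows "f \<in> left_hom R P Q \<Longrightarrow> inv_into (carrier P) f \<in> left_hom R Q P"
    and "f \<in> right_hom R P Q \<Longrightarrow> inv_into (carrier P) f \<in> right_hom R Q P"
proof -
  let ?k = "inv_into (carrier P) f"
  have k: "?k y \<in> carrier P" "f (?k y) = y" if "y \<in> carrier Q" for y
    using that b by (auto simp: bij_betw_def f_inv_into_f intro!: inv_into_into)
  have e: "?k y = x" if "x \<in> carrier P" "f x = y" for x y
    using that b by (auto simp: bij_betw_def)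
  { assume f: "f \<in> left_hom R P Q"
    show "?k \<in> left_hom R Q P"
      unfolding left_hom_def
      by (auto simp: k left_homD[OF f] lsmult_closed intro!: e) }
  { assume f: "f \<in> right_hom R P Q"
    show "?k \<in> right_hom R Q P"
      unfolding right_hom_def
      by (auto simp: k right_homD[OF f] rsmult_closed intro!: e) }
qed

end

lemma bimod_isomorphic_sym:
  assumes "bimodule R P" "bimod_isomorphic R P Q"
  shows "bimod_isomorphic R Q P"
  using assms(2) bimodule.bij_inverse_hom[OF assms(1)] unfolding bimod_isomorphic_def
  by (meson IntD1 IntD2 IntI bij_betw_inv_into)

lemma bimod_isomorphic_trans:
  assumes "bimod_isomorphic R P Q" "bimod_isomorphic R Q S"
  shows "bimod_isomorphic R P S"
proof -
  obtain f g where "f \<in> left_hom R P Q" "f \<in> right_hom R P Q" "bij_betw f (carrier P) (carrier Q)"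
    "g \<in> left_hom R Q S" "g \<in> right_hom R Q S" "bij_betw g (carrier Q) (carrier S)"
    using assms unfolding bimod_isomorphic_def by auto
  then show ?thesis unfolding bimod_isomorphic_def
    by (intro bexI[of _ "g \<circ> f"]) (auto intro: left_hom_comp right_hom_comp bij_betw_trans)
qed

lemma bimod_class_eq:
  assumes "bimodule R P" "bimod_isomorphic R P Q"
  shows "bimod_class R P = bimod_class R Q"
  using bimod_isomorphic_trans[OF bimod_isomorphic_sym[OF assms]] bimod_isomorphic_trans[OF assms(2)]
  unfolding bimod_class_def by auto

lemma partially_invertible_iso:
  assumes P: "partially_invertible R P" and Q: "bimodule R Q" and iso: "bimod_isomorphic R P Q"
  shows "partially_invertible R Q"
proof -
  have bP: "bimodule R P" using P by (simp add: partially_invertible_def)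
  obtain f where f: "f \<in> left_hom R P Q" "f \<in> right_hom R P Q" "bij_betw f (carrier P) (carrier Q)"
    using iso unfolding bimod_isomorphic_def by auto
  define k where "k = inv_into (carrier P) f"
  have k: "k \<in> left_hom R Q P" "k \<in> right_hom R Q P"
    using bimodule.bij_inverse_hom[OF bP f(3)] f k_def by auto
  have fk: "f (k y) = y" if "y \<in> carrier Q" for y
    using that f(3) k_def by (auto simp: bij_betw_def f_inv_into_f)
  have kc: "k y \<in> carrier P" if "y \<in> carrier Q" for y using k that left_homD by metis
  have kf: "k (f x) = x" if "x \<in> carrier P" for x
    using that f(3) k_def by (auto simp: bij_betw_def)
  have 1: "left_fg_projective R Q"
  proof -
    obtain n i p where "i \<in> left_hom R P (free_bimod R n)" "p \<in> left_hom R (free_bimod R n) P"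
      "\<forall>x \<in> carrier P. p (i x) = x" using P unfolding partially_invertible_def left_fg_projective_def by blast
    then show ?thesis unfolding left_fg_projective_def
      using left_hom_comp[OF k(1)] left_hom_comp[OF _ f(1)] kc fk
      by (intro exI[of _ n] bexI[of _ "i \<circ> k"] bexI[of _ "f \<circ> p"]) auto
  qed
  have 2: "right_fg_projective R Q"
  proof -
    obtain n i p where "i \<in> right_hom R P (free_bimod R n)" "p \<in> right_hom R (free_bimod R n) P"
      "\<forall>x \<in> carrier P. p (i x) = x" using P unfolding partially_invertible_def right_fg_projective_def by blast
    then show ?thesis unfolding right_fg_projective_def
      using right_hom_comp[OF k(2)] right_hom_comp[OF _ f(2)] kc fk
      by (intro exI[of _ n] bexI[of _ "i \<circ> k"] bexI[of _ "f \<circ> p"]) auto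
  qed
  have 3: "\<exists>a \<in> carrier R. \<forall>x \<in> carrier Q. h x = a \<odot>\<^bsub>Q\<^esub> x" if h: "h \<in> right_hom R Q Q" for h
  proof -
    have "k \<circ> (h \<circ> f) \<in> right_hom R P P"
      by (rule right_hom_comp[OF right_hom_comp[OF f(2) h] k(2)])
    then obtain a where a: "a \<in> carrier R" "\<forall>x \<in> carrier P. (k \<circ> (h \<circ> f)) x = a \<odot>\<^bsub>P\<^esub> x"
      using P unfolding partially_invertible_def by blast
    have "h x = a \<odot>\<^bsub>Q\<^esub> x" if x: "x \<in> carrier Q" for x
    proof -
      have "k (h x) = a \<odot>\<^bsub>P\<^esub> k x" using a(2) kc[OF x] fk[OF x] by force
      then have "f (k (h x)) = a \<odot>\<^bsub>Q\<^esub> x" using left_homD(3)[OF f(1) a(1) kc[OF x]] fk[OF x] by simp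
      then show ?thesis using fk right_homD(1)[OF h x] by simp
    qed
    then show ?thesis using a(1) by blast
  qed
  have 4: "\<exists>a \<in> carrier R. \<forall>x \<in> carrier Q. h x = x \<odot>\<^sub>r\<^bsub>Q\<^esub> a" if h: "h \<in> left_hom R Q Q" for h
  proof -
    have "k \<circ> (h \<circ> f) \<in> left_hom R P P"
      by (rule left_hom_comp[OF left_hom_comp[OF f(1) h] k(1)])
    then obtain a where a: "a \<in> carrier R" "\<forall>x \<in> carrier P. (k \<circ> (h \<circ> f)) x = x \<odot>\<^sub>r\<^bsub>P\<^esub> a"
      using P unfolding partially_invertible_def by blast
    have "h x = x \<odot>\<^sub>r\<^bsub>Q\<^esub> a" if x: "x \<in> carrier Q" for x
    proof -
      have "k (h x) = k x \<odot>\<^sub>r\<^bsub>P\<^esub> a" using a(2) kc[OF x] fk[OF x] by force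
      then have "f (k (h x)) = x \<odot>\<^sub>r\<^bsub>Q\<^esub> a" using right_homD(3)[OF f(2) a(1) kc[OF x]] fk[OF x] by simp
      then show ?thesis using fk left_homD(1)[OF h x] by simp
    qed
    then show ?thesis using a(1) by blast
  qed
  show ?thesis unfolding partially_invertible_def using Q 1 2 3 4 by blast
qed

text \<open>A copy of \<open>P\<close> whose elements are constant functions, used to move \<open>P\<close> into the type of \<^const>\<open>PicS\<close>.\<close>

definition const_copy :: "('a, 'p) bimod \<Rightarrow> ('a, nat \<Rightarrow> 'p) bimod"
  where "const_copy P = \<lparr>carrier = (\<lambda>x _. x) ` carrier P, mult = (\<lambda>x y _. mult P (x 0) (y 0)),
    one = (\<lambda>_. one P), zero = (\<lambda>_. zero P), add = (\<lambda>x y _. add P (x 0) (y 0)),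
    smult = (\<lambda>a x _. smult P a (x 0)), rsmult = (\<lambda>x a _. rsmult P (x 0) a)\<rparr>"

lemma const_copy:
  assumes "bimodule R P"
  shows "bimodule R (const_copy P)" "bimod_isomorphic R P (const_copy P)"
proof -
  interpret bimodule R P by fact
  have "abelian_group (const_copy P)"
  proof (rule abelian_groupI)
    show "\<exists>y\<in>carrier (const_copy P). y \<oplus>\<^bsub>const_copy P\<^esub> x = \<zero>\<^bsub>const_copy P\<^esub>"
      if "x \<in> carrier (const_copy P)" for x
      using that P.l_neg
      by (intro bexI[of _ "\<lambda>_. \<ominus>\<^bsub>P\<^esub> (x 0)"]) (auto simp: const_copy_def)
    show "x \<oplus>\<^bsub>const_copy P\<^esub> y = y \<oplus>\<^bsub>const_copy P\<^esub> x"
      if "x \<in> carrier (const_copy P)" "y \<in> carrier (const_copy P)" for x y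
      using that P.a_comm by (auto simp: const_copy_def)
  qed (auto simp: const_copy_def P.a_assoc)
  then show "bimodule R (const_copy P)"
    by (intro bimodule.intro bimodule_axioms.intro R.ring_axioms)
      (auto simp: const_copy_def lsmult_closed lsmult_l_distr lsmult_r_distr lsmult_assoc lsmult_one
        rsmult_closed rsmult_l_distr rsmult_r_distr rsmult_assoc rsmult_one lsmult_rsmult)
  show "bimod_isomorphic R P (const_copy P)"
    unfolding bimod_isomorphic_def left_hom_def right_hom_def
    by (intro bexI[of _ "\<lambda>x _. x"]) (auto simp: const_copy_def bij_betw_def inj_on_def fun_eq_iff)
qed

lemma bimod_class_PicS:
  fixes P :: "('a, 'a) bimod"
  assumes P: "partially_invertible R P"
  shows "bimod_class R P \<in> PicS R"
proof -
  have b: "bimodule R P" using P by (simp add: partially_invertible_def)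
  have "bimod_class R P = bimod_class R (const_copy P)"
    by (rule bimod_class_eq[OF b const_copy(2)[OF b]])
  moreover have "partially_invertible R (const_copy P)"
    by (rule partially_invertible_iso[OF P const_copy[OF b]])
  ultimately show ?thesis unfolding PicS_def by blast
qed


section \<open>The components and the twisted bimodules are partially invertible\<close>

lemma (in ring) ideal_prod_finsum:
  assumes X: "X \<subseteq> carrier R" and Y: "Y \<subseteq> carrier R" and z: "z \<in> X \<cdot> Y"
  obtains n :: nat and a b where "\<And>i. i < n \<Longrightarrow> a i \<in> X" "\<And>i. i < n \<Longrightarrow> b i \<in> Y"
    "z = (\<Oplus>i\<in>{..<n}. a i \<otimes> b i)"
proof -
  define S where "S = {w. \<exists>(n :: nat) a b. (\<forall>i<n. a i \<in> X \<and> b i \<in> Y) \<and> w = (\<Oplus>i\<in>{..<n}. a i \<otimes> b i)}"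
  have Sc: "w \<in> carrier R" if "w \<in> S" for w
    using that X Y unfolding S_def by (auto intro!: finsum_closed)
  have "z \<in> carrier R \<and> (\<forall>w \<in> S. z \<oplus> w \<in> S)" using z
  proof induction
    case (prod x y)
    have c: "x \<otimes> y \<in> carrier R" using prod X Y by auto
    have "x \<otimes> y \<oplus> w \<in> S" if w: "w \<in> S" for w
    proof -
      obtain n :: nat and a b where h: "\<forall>i<n. a i \<in> X \<and> b i \<in> Y" "w = (\<Oplus>i\<in>{..<n}. a i \<otimes> b i)"
        using w unfolding S_def by blast
      let ?a = "a(n := x)" and ?b = "b(n := y)"
      have "(\<Oplus>i\<in>{..<Suc n}. ?a i \<otimes> ?b i) = ?a n \<otimes> ?b n \<oplus> (\<Oplus>i\<in>{..<n}. ?a i \<otimes> ?b i)"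
        unfolding lessThan_Suc by (rule finsum_insert) (use h X Y prod in \<open>auto intro!: m_closed\<close>)
      also have "(\<Oplus>i\<in>{..<n}. ?a i \<otimes> ?b i) = w"
        unfolding h by (rule finsum_cong') (use h X Y in \<open>auto intro!: m_closed\<close>)
      finally have "x \<otimes> y \<oplus> w = (\<Oplus>i\<in>{..<Suc n}. ?a i \<otimes> ?b i)" by simp
      moreover have "\<forall>i<Suc n. ?a i \<in> X \<and> ?b i \<in> Y" using h prod by (auto simp: less_Suc_eq)
      ultimately show ?thesis unfolding S_def by blast
    qed
    then show ?case using c by blast
  next
    case (sum s t)
    then show ?case using Sc by (simp add: a_assoc)
  qed
  moreover have "\<zero> \<in> S" unfolding S_def by (auto intro!: exI[of _ "0::nat"])
  ultimately have "z \<in> S" by (metis r_zero)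
  then show ?thesis using that unfolding S_def by blast
qed

context epsilon_strongly_graded_ring begin

lemma gr_finsum:
  fixes n :: nat
  assumes g: "g \<in> carrier G" and x: "\<And>i. i < n \<Longrightarrow> x i \<in> gr g"
  shows "(\<Oplus>\<^bsub>A\<^esub>i\<in>{..<n}. x i) \<in> gr g"
  using x
proof (induction n)
  case 0 then show ?case using gr_subgroup[OF g] additive_subgroup.zero_closed by auto
next
  case (Suc n)
  have "(\<Oplus>\<^bsub>A\<^esub>i\<in>{..<Suc n}. x i) = x n \<oplus>\<^bsub>A\<^esub> (\<Oplus>\<^bsub>A\<^esub>i\<in>{..<n}. x i)"
    unfolding lessThan_Suc by (rule A.finsum_insert) (use Suc gr_carrier[OF g] in auto)
  then show ?case using Suc gr_subgroup[OF g] additive_subgroup.a_closed by fastforce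
qed

lemma gr_additive_finsum:
  fixes n :: nat
  assumes g: "g \<in> carrier G" and x: "\<And>i. i < n \<Longrightarrow> x i \<in> gr g"
    and f: "\<And>x. x \<in> gr g \<Longrightarrow> f x \<in> gr g"
      "\<And>x y. x \<in> gr g \<Longrightarrow> y \<in> gr g \<Longrightarrow> f (x \<oplus>\<^bsub>A\<^esub> y) = f x \<oplus>\<^bsub>A\<^esub> f y"
  shows "f (\<Oplus>\<^bsub>A\<^esub>i\<in>{..<n}. x i) = (\<Oplus>\<^bsub>A\<^esub>i\<in>{..<n}. f (x i))"
  using x
proof (induction n)
  case 0
  have z: "\<zero>\<^bsub>A\<^esub> \<in> gr g" using gr_subgroup[OF g] additive_subgroup.zero_closed by auto
  have "f \<zero>\<^bsub>A\<^esub> \<oplus>\<^bsub>A\<^esub> f \<zero>\<^bsub>A\<^esub> = f \<zero>\<^bsub>A\<^esub>" using f(2)[OF z z] by simp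
  then show ?case using f(1)[OF z] gr_carrier[OF g] by simp
next
  case (Suc n)
  have "(\<Oplus>\<^bsub>A\<^esub>i\<in>{..<Suc n}. x i) = x n \<oplus>\<^bsub>A\<^esub> (\<Oplus>\<^bsub>A\<^esub>i\<in>{..<n}. x i)"
    unfolding lessThan_Suc by (rule A.finsum_insert) (use Suc gr_carrier[OF g] in auto)
  moreover have "(\<Oplus>\<^bsub>A\<^esub>i\<in>{..<Suc n}. f (x i)) = f (x n) \<oplus>\<^bsub>A\<^esub> (\<Oplus>\<^bsub>A\<^esub>i\<in>{..<n}. f (x i))"
    unfolding lessThan_Suc by (rule A.finsum_insert) (use Suc gr_carrier[OF g] f(1) in auto)
  ultimately show ?case using f(2)[of "x n"] gr_finsum[OF g, of n x] Suc by simp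
qed

lemma gr_partially_invertible:
  assumes g: "g \<in> carrier G"
  shows "partially_invertible R (sub_bimod A (gr g))"
proof -
  let ?P = "sub_bimod A (gr g)"
  let ?g' = "inv\<^bsub>G\<^esub> g"
  have g': "?g' \<in> carrier G" using g by simp
  note Rdefs = sub_bimod_def principal_component_def
  have sub: "gr g \<subseteq> carrier A" "gr ?g' \<subseteq> carrier A" using gr_carrier[OF g] gr_carrier[OF g'] by auto
  have c1: "a \<in> carrier A" if "a \<in> gr \<one>\<^bsub>G\<^esub>" for a using that gr_carrier[of "\<one>\<^bsub>G\<^esub>"] by simp
  have cg: "a \<in> carrier A" if "a \<in> gr g" for a using that gr_carrier g by simp
  have cg': "a \<in> carrier A" if "a \<in> gr ?g'" for a using that gr_carrier g' by simp
  have m1: "a \<otimes>\<^bsub>A\<^esub> b \<in> gr g" if "a \<in> gr \<one>\<^bsub>G\<^esub>" "b \<in> gr g" for a b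
    using gr_mult[of "\<one>\<^bsub>G\<^esub>" g a b] that g by simp
  have m2: "b \<otimes>\<^bsub>A\<^esub> a \<in> gr g" if "a \<in> gr \<one>\<^bsub>G\<^esub>" "b \<in> gr g" for a b
    using gr_mult[of g "\<one>\<^bsub>G\<^esub>" b a] that g by simp
  have m3: "a \<otimes>\<^bsub>A\<^esub> b \<in> gr \<one>\<^bsub>G\<^esub>" if "a \<in> gr g" "b \<in> gr ?g'" for a b
    using gr_mult[of g ?g' a b] that g by simp
  have m4: "b \<otimes>\<^bsub>A\<^esub> a \<in> gr \<one>\<^bsub>G\<^esub>" if "a \<in> gr g" "b \<in> gr ?g'" for a b
    using gr_mult[of ?g' g b a] that g by simp
  obtain n :: nat and a b where ab: "\<And>i. i < n \<Longrightarrow> a i \<in> gr g" "\<And>i. i < n \<Longrightarrow> b i \<in> gr ?g'"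
    and e: "eps g = (\<Oplus>\<^bsub>A\<^esub>i\<in>{..<n}. a i \<otimes>\<^bsub>A\<^esub> b i)"
    using A.ideal_prod_finsum[OF sub epsilon_prod[OF g]] by blast
  have "eps ?g' \<in> gr ?g' \<cdot>\<^bsub>A\<^esub> gr g" using epsilon_prod[OF g'] g by simp
  from A.ideal_prod_finsum[OF sub(2,1) this]
  obtain n' :: nat and b' a' where ab': "\<And>i. i < n' \<Longrightarrow> b' i \<in> gr ?g'" "\<And>i. i < n' \<Longrightarrow> a' i \<in> gr g"
    and e': "eps ?g' = (\<Oplus>\<^bsub>A\<^esub>i\<in>{..<n'}. b' i \<otimes>\<^bsub>A\<^esub> a' i)" by blast
  have ex: "x = (\<Oplus>\<^bsub>A\<^esub>i\<in>{..<n}. a i \<otimes>\<^bsub>A\<^esub> (b i \<otimes>\<^bsub>A\<^esub> x))" if x: "x \<in> gr g" for x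
  proof -
    have "x = eps g \<otimes>\<^bsub>A\<^esub> x" using epsilon_left[OF g x] by simp
    also have "\<dots> = (\<Oplus>\<^bsub>A\<^esub>i\<in>{..<n}. (a i \<otimes>\<^bsub>A\<^esub> b i) \<otimes>\<^bsub>A\<^esub> x)"
      unfolding e by (rule A.finsum_ldistr) (use ab cg cg' x in auto)
    also have "\<dots> = (\<Oplus>\<^bsub>A\<^esub>i\<in>{..<n}. a i \<otimes>\<^bsub>A\<^esub> (b i \<otimes>\<^bsub>A\<^esub> x))"
      by (rule A.finsum_cong') (use ab cg cg' x in \<open>auto simp: A.m_assoc\<close>)
    finally show ?thesis .
  qed
  have ex': "x = (\<Oplus>\<^bsub>A\<^esub>i\<in>{..<n'}. (x \<otimes>\<^bsub>A\<^esub> b' i) \<otimes>\<^bsub>A\<^esub> a' i)" if x: "x \<in> gr g" for x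
  proof -
    have "x = x \<otimes>\<^bsub>A\<^esub> eps ?g'" using epsilon_right[OF g x] by simp
    also have "\<dots> = (\<Oplus>\<^bsub>A\<^esub>i\<in>{..<n'}. x \<otimes>\<^bsub>A\<^esub> (b' i \<otimes>\<^bsub>A\<^esub> a' i))"
      unfolding e' by (rule A.finsum_rdistr) (use ab' cg cg' x in auto)
    also have "\<dots> = (\<Oplus>\<^bsub>A\<^esub>i\<in>{..<n'}. (x \<otimes>\<^bsub>A\<^esub> b' i) \<otimes>\<^bsub>A\<^esub> a' i)"
      by (rule A.finsum_cong') (use ab' cg cg' x in \<open>auto simp: A.m_assoc\<close>)
    finally show ?thesis .
  qed
  let ?i = "\<lambda>x. \<lambda>i\<in>{..<n'}. x \<otimes>\<^bsub>A\<^esub> b' i"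
  let ?p = "\<lambda>x. \<Oplus>\<^bsub>A\<^esub>i\<in>{..<n'}. x i \<otimes>\<^bsub>A\<^esub> a' i"
  have 1: "left_fg_projective R ?P"
    unfolding left_fg_projective_def
  proof (rule exI[of _ n'], rule bexI[of _ ?i], rule bexI[of _ ?p], rule ballI)
    show "?p (?i x) = x" if "x \<in> carrier ?P" for x
    proof -
      have x: "x \<in> gr g" using that by (simp add: sub_bimod_def)
      have "?p (?i x) = (\<Oplus>\<^bsub>A\<^esub>i\<in>{..<n'}. (x \<otimes>\<^bsub>A\<^esub> b' i) \<otimes>\<^bsub>A\<^esub> a' i)"
        by (rule A.finsum_cong') (use ab' cg cg' x in auto)
      then show ?thesis using ex'[OF x] by simp
    qed
    show "?i \<in> left_hom R ?P (free_bimod R n')"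
      using ab' cg cg' c1 m3 by (auto simp: left_hom_def free_bimod_def Rdefs A.l_distr A.m_assoc
        intro!: restrict_ext)
    show "?p \<in> left_hom R (free_bimod R n') ?P"
    proof -
      have p1: "?p x \<in> gr g" if "x \<in> {..<n'} \<rightarrow>\<^sub>E gr \<one>\<^bsub>G\<^esub>" for x
        by (rule gr_finsum[OF g]) (use that ab' in \<open>auto intro!: m1\<close>)
      have p2: "?p (\<lambda>i\<in>{..<n'}. x i \<oplus>\<^bsub>A\<^esub> y i) = ?p x \<oplus>\<^bsub>A\<^esub> ?p y"
        if "x \<in> {..<n'} \<rightarrow>\<^sub>E gr \<one>\<^bsub>G\<^esub>" "y \<in> {..<n'} \<rightarrow>\<^sub>E gr \<one>\<^bsub>G\<^esub>" for x y
      proof -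
        have xy: "x i \<in> carrier A" "y i \<in> carrier A" "a' i \<in> carrier A" if "i < n'" for i
          using that \<open>x \<in> _\<close> \<open>y \<in> _\<close> c1 ab' cg by auto
        have "?p (\<lambda>i\<in>{..<n'}. x i \<oplus>\<^bsub>A\<^esub> y i) = (\<Oplus>\<^bsub>A\<^esub>i\<in>{..<n'}. x i \<otimes>\<^bsub>A\<^esub> a' i \<oplus>\<^bsub>A\<^esub> y i \<otimes>\<^bsub>A\<^esub> a' i)"
          by (rule A.finsum_cong') (use xy in \<open>auto simp: A.l_distr\<close>)
        also have "\<dots> = ?p x \<oplus>\<^bsub>A\<^esub> ?p y" by (rule A.finsum_addf) (use xy in auto)
        finally show ?thesis .
      qed
      have p3: "?p (\<lambda>i\<in>{..<n'}. r \<otimes>\<^bsub>A\<^esub> x i) = r \<otimes>\<^bsub>A\<^esub> ?p x"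
        if "x \<in> {..<n'} \<rightarrow>\<^sub>E gr \<one>\<^bsub>G\<^esub>" "r \<in> gr \<one>\<^bsub>G\<^esub>" for r x
      proof -
        have xy: "x i \<in> carrier A" "a' i \<in> carrier A" if "i < n'" for i
          using that \<open>x \<in> _\<close> c1 ab' cg by auto
        have "?p (\<lambda>i\<in>{..<n'}. r \<otimes>\<^bsub>A\<^esub> x i) = (\<Oplus>\<^bsub>A\<^esub>i\<in>{..<n'}. r \<otimes>\<^bsub>A\<^esub> (x i \<otimes>\<^bsub>A\<^esub> a' i))"
          by (rule A.finsum_cong') (use xy c1[OF that(2)] in \<open>auto simp: A.m_assoc\<close>)
        also have "\<dots> = r \<otimes>\<^bsub>A\<^esub> ?p x"
          by (rule A.finsum_rdistr[symmetric]) (use xy c1[OF that(2)] in auto)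
        finally show ?thesis .
      qed
      show ?thesis using p1 p2 p3 by (auto simp: left_hom_def free_bimod_def Rdefs)
    qed
  qed
  let ?i = "\<lambda>x. \<lambda>i\<in>{..<n}. b i \<otimes>\<^bsub>A\<^esub> x"
  let ?p = "\<lambda>x. \<Oplus>\<^bsub>A\<^esub>i\<in>{..<n}. a i \<otimes>\<^bsub>A\<^esub> x i"
  have 2: "right_fg_projective R ?P"
    unfolding right_fg_projective_def
  proof (rule exI[of _ n], rule bexI[of _ ?i], rule bexI[of _ ?p], rule ballI)
    show "?p (?i x) = x" if "x \<in> carrier ?P" for x
    proof -
      have x: "x \<in> gr g" using that by (simp add: sub_bimod_def)
      have "?p (?i x) = (\<Oplus>\<^bsub>A\<^esub>i\<in>{..<n}. a i \<otimes>\<^bsub>A\<^esub> (b i \<otimes>\<^bsub>A\<^esub> x))"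
        by (rule A.finsum_cong') (use ab cg cg' x in auto)
      then show ?thesis using ex[OF x] by simp
    qed
    show "?i \<in> right_hom R ?P (free_bimod R n)"
      using ab cg cg' c1 m4 by (auto simp: right_hom_def free_bimod_def Rdefs A.r_distr A.m_assoc
        intro!: restrict_ext)
    show "?p \<in> right_hom R (free_bimod R n) ?P"
    proof -
      have p1: "?p x \<in> gr g" if "x \<in> {..<n} \<rightarrow>\<^sub>E gr \<one>\<^bsub>G\<^esub>" for x
        by (rule gr_finsum[OF g]) (use that ab in \<open>auto intro!: m2\<close>)
      have p2: "?p (\<lambda>i\<in>{..<n}. x i \<oplus>\<^bsub>A\<^esub> y i) = ?p x \<oplus>\<^bsub>A\<^esub> ?p y"
        if "x \<in> {..<n} \<rightarrow>\<^sub>E gr \<one>\<^bsub>G\<^esub>" "y \<in> {..<n} \<rightarrow>\<^sub>E gr \<one>\<^bsub>G\<^esub>" for x y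
      proof -
        have xy: "x i \<in> carrier A" "y i \<in> carrier A" "a i \<in> carrier A" if "i < n" for i
          using that \<open>x \<in> _\<close> \<open>y \<in> _\<close> c1 ab cg by auto
        have "?p (\<lambda>i\<in>{..<n}. x i \<oplus>\<^bsub>A\<^esub> y i) = (\<Oplus>\<^bsub>A\<^esub>i\<in>{..<n}. a i \<otimes>\<^bsub>A\<^esub> x i \<oplus>\<^bsub>A\<^esub> a i \<otimes>\<^bsub>A\<^esub> y i)"
          by (rule A.finsum_cong') (use xy in \<open>auto simp: A.r_distr\<close>)
        also have "\<dots> = ?p x \<oplus>\<^bsub>A\<^esub> ?p y" by (rule A.finsum_addf) (use xy in auto)
        finally show ?thesis .
      qed
      have p3: "?p (\<lambda>i\<in>{..<n}. x i \<otimes>\<^bsub>A\<^esub> r) = ?p x \<otimes>\<^bsub>A\<^esub> r"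
        if "x \<in> {..<n} \<rightarrow>\<^sub>E gr \<one>\<^bsub>G\<^esub>" "r \<in> gr \<one>\<^bsub>G\<^esub>" for r x
      proof -
        have xy: "x i \<in> carrier A" "a i \<in> carrier A" if "i < n" for i
          using that \<open>x \<in> _\<close> c1 ab cg by auto
        have "?p (\<lambda>i\<in>{..<n}. x i \<otimes>\<^bsub>A\<^esub> r) = (\<Oplus>\<^bsub>A\<^esub>i\<in>{..<n}. (a i \<otimes>\<^bsub>A\<^esub> x i) \<otimes>\<^bsub>A\<^esub> r)"
          by (rule A.finsum_cong') (use xy c1[OF that(2)] in \<open>auto simp: A.m_assoc\<close>)
        also have "\<dots> = ?p x \<otimes>\<^bsub>A\<^esub> r"
          by (rule A.finsum_ldistr[symmetric]) (use xy c1[OF that(2)] in auto)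
        finally show ?thesis .
      qed
      show ?thesis using p1 p2 p3 by (auto simp: right_hom_def free_bimod_def Rdefs)
    qed
  qed
  have 3: "\<exists>c \<in> carrier R. \<forall>x \<in> carrier ?P. f x = c \<odot>\<^bsub>?P\<^esub> x" if f: "f \<in> right_hom R ?P ?P" for f
  proof -
    have fg: "f x \<in> gr g" if "x \<in> gr g" for x using right_homD(1)[OF f] that by (simp add: Rdefs)
    have fa: "f (x \<oplus>\<^bsub>A\<^esub> y) = f x \<oplus>\<^bsub>A\<^esub> f y" if "x \<in> gr g" "y \<in> gr g" for x y
      using right_homD(2)[OF f] that by (simp add: Rdefs)
    have fm: "f (x \<otimes>\<^bsub>A\<^esub> r) = f x \<otimes>\<^bsub>A\<^esub> r" if "x \<in> gr g" "r \<in> gr \<one>\<^bsub>G\<^esub>" for x r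
      using right_homD(3)[OF f] that by (simp add: Rdefs)
    let ?c = "\<Oplus>\<^bsub>A\<^esub>i\<in>{..<n}. f (a i) \<otimes>\<^bsub>A\<^esub> b i"
    have "?c \<in> gr \<one>\<^bsub>G\<^esub>" by (rule gr_finsum) (use ab fg m3 in auto)
    moreover have "f x = ?c \<otimes>\<^bsub>A\<^esub> x" if x: "x \<in> gr g" for x
    proof -
      have "f x = f (\<Oplus>\<^bsub>A\<^esub>i\<in>{..<n}. a i \<otimes>\<^bsub>A\<^esub> (b i \<otimes>\<^bsub>A\<^esub> x))" using ex[OF x] by simp
      also have "\<dots> = (\<Oplus>\<^bsub>A\<^esub>i\<in>{..<n}. f (a i \<otimes>\<^bsub>A\<^esub> (b i \<otimes>\<^bsub>A\<^esub> x)))"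
        by (rule gr_additive_finsum[OF g]) (use ab m2 m4 x fg fa in auto)
      also have "\<dots> = (\<Oplus>\<^bsub>A\<^esub>i\<in>{..<n}. (f (a i) \<otimes>\<^bsub>A\<^esub> b i) \<otimes>\<^bsub>A\<^esub> x)"
        by (rule A.finsum_cong') (use ab m4 x fg fm cg cg' in \<open>auto simp: A.m_assoc\<close>)
      also have "\<dots> = ?c \<otimes>\<^bsub>A\<^esub> x" 
        by (rule A.finsum_ldistr[symmetric]) (use ab x fg cg cg' in auto)
      finally show ?thesis .
    qed
    ultimately show ?thesis by (auto simp: Rdefs)
  qed
  have 4: "\<exists>c \<in> carrier R. \<forall>x \<in> carrier ?P. f x = x \<odot>\<^sub>r\<^bsub>?P\<^esub> c" if f: "f \<in> left_hom R ?P ?P" for f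
  proof -
    have fg: "f x \<in> gr g" if "x \<in> gr g" for x using left_homD(1)[OF f] that by (simp add: Rdefs)
    have fa: "f (x \<oplus>\<^bsub>A\<^esub> y) = f x \<oplus>\<^bsub>A\<^esub> f y" if "x \<in> gr g" "y \<in> gr g" for x y
      using left_homD(2)[OF f] that by (simp add: Rdefs)
    have fm: "f (r \<otimes>\<^bsub>A\<^esub> x) = r \<otimes>\<^bsub>A\<^esub> f x" if "x \<in> gr g" "r \<in> gr \<one>\<^bsub>G\<^esub>" for x r
      using left_homD(3)[OF f] that by (simp add: Rdefs)
    let ?c = "\<Oplus>\<^bsub>A\<^esub>i\<in>{..<n'}. b' i \<otimes>\<^bsub>A\<^esub> f (a' i)"
    have "?c \<in> gr \<one>\<^bsub>G\<^esub>" by (rule gr_finsum) (use ab' fg m4 in auto)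
    moreover have "f x = x \<otimes>\<^bsub>A\<^esub> ?c" if x: "x \<in> gr g" for x
    proof -
      have "f x = f (\<Oplus>\<^bsub>A\<^esub>i\<in>{..<n'}. (x \<otimes>\<^bsub>A\<^esub> b' i) \<otimes>\<^bsub>A\<^esub> a' i)" using ex'[OF x] by simp
      also have "\<dots> = (\<Oplus>\<^bsub>A\<^esub>i\<in>{..<n'}. f ((x \<otimes>\<^bsub>A\<^esub> b' i) \<otimes>\<^bsub>A\<^esub> a' i))"
        by (rule gr_additive_finsum[OF g]) (use ab' m1 m3 x fg fa in auto)
      also have "\<dots> = (\<Oplus>\<^bsub>A\<^esub>i\<in>{..<n'}. x \<otimes>\<^bsub>A\<^esub> (b' i \<otimes>\<^bsub>A\<^esub> f (a' i)))"
      proof (rule A.finsum_cong')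
        fix i assume i: "i \<in> {..<n'}"
        have "f ((x \<otimes>\<^bsub>A\<^esub> b' i) \<otimes>\<^bsub>A\<^esub> a' i) = (x \<otimes>\<^bsub>A\<^esub> b' i) \<otimes>\<^bsub>A\<^esub> f (a' i)"
          using ab' i m3 x by (intro fm) auto
        then show "f ((x \<otimes>\<^bsub>A\<^esub> b' i) \<otimes>\<^bsub>A\<^esub> a' i) = x \<otimes>\<^bsub>A\<^esub> (b' i \<otimes>\<^bsub>A\<^esub> f (a' i))"
          using ab' i x fg cg cg' by (simp add: A.m_assoc)
      qed (use ab' x fg cg cg' in auto)
      also have "\<dots> = x \<otimes>\<^bsub>A\<^esub> ?c" 
        by (rule A.finsum_rdistr[symmetric]) (use ab' x fg cg cg' in auto)
      finally show ?thesis .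
    qed
    ultimately show ?thesis by (auto simp: Rdefs)
  qed
  show ?thesis unfolding partially_invertible_def using gr_bimodule[OF g] 1 2 3 4 by blast
qed

lemma Comp_subset_PicS: "Comp G A gr \<subseteq> PicS R"
  unfolding Comp_def using gr_partially_invertible bimod_class_PicS by blast

end

lemma twisted_partially_invertible:
  assumes R: "ring R" and \<theta>: "\<theta> \<in> I_u R"
  shows "partially_invertible R (twisted_bimod R \<theta>)"
proof -
  interpret R: ring R by fact
  define e f t where "e = dom_one \<theta>" and "f = im_one \<theta>" and "t = iso_map \<theta>"
  define D I k where "D = PIdl\<^bsub>R\<^esub> e" and "I = PIdl\<^bsub>R\<^esub> f" and "k = inv_into D t"
  note defs = e_def f_def t_def D_def I_def
  let ?P = "twisted_bimod R \<theta>"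
  have e: "e \<in> carrier R" "e \<otimes>\<^bsub>R\<^esub> e = e" "\<And>x. x \<in> carrier R \<Longrightarrow> e \<otimes>\<^bsub>R\<^esub> x = x \<otimes>\<^bsub>R\<^esub> e"
    and f: "f \<in> carrier R" "f \<otimes>\<^bsub>R\<^esub> f = f" "\<And>x. x \<in> carrier R \<Longrightarrow> f \<otimes>\<^bsub>R\<^esub> x = x \<otimes>\<^bsub>R\<^esub> f"
    using \<theta> by (auto simp: I_u_def central_idempotents_def e_def f_def)
  have D: "x \<in> D \<longleftrightarrow> x \<in> carrier R \<and> x \<otimes>\<^bsub>R\<^esub> e = x" for x
    unfolding D_def cgenideal_def using e(1,2) by (auto simp: R.m_assoc intro!: exI[of _ x])
  have I: "x \<in> I \<longleftrightarrow> x \<in> carrier R \<and> x \<otimes>\<^bsub>R\<^esub> f = x" for x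
    unfolding I_def cgenideal_def using f(1,2) by (auto simp: R.m_assoc intro!: exI[of _ x])
  have t: "\<And>x. x \<in> D \<Longrightarrow> t x \<in> I" "\<And>x y. x \<in> D \<Longrightarrow> y \<in> D \<Longrightarrow> t (x \<otimes>\<^bsub>R\<^esub> y) = t x \<otimes>\<^bsub>R\<^esub> t y"
    "\<And>x y. x \<in> D \<Longrightarrow> y \<in> D \<Longrightarrow> t (x \<oplus>\<^bsub>R\<^esub> y) = t x \<oplus>\<^bsub>R\<^esub> t y" "t e = f"
    and bij: "bij_betw t D I"
    using \<theta> by (auto simp: I_u_def ring_iso_def unital_ideal_def defs ring_hom_def)
  have k: "k y \<in> D" "t (k y) = y" if "y \<in> I" for y
    using that bij by (auto simp: k_def bij_betw_def f_inv_into_f intro!: inv_into_into)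
  have kt: "k y = x" if "x \<in> D" "t x = y" for x y
    using that bij by (auto simp: k_def bij_betw_def)
  have De: "a \<otimes>\<^bsub>R\<^esub> e \<in> D" if "a \<in> carrier R" for a using that e(1,2) by (simp add: D R.m_assoc)
  have If: "a \<otimes>\<^bsub>R\<^esub> f \<in> I" if "a \<in> carrier R" for a using that f(1,2) by (simp add: I R.m_assoc)
  have fI: "f \<in> I" using f(1,2) by (simp add: I)
  have Ic: "x \<in> carrier R" if "x \<in> I" for x using that I by simp
  have Dc: "x \<in> carrier R" if "x \<in> D" for x using that D by simp
  have Im: "a \<otimes>\<^bsub>R\<^esub> x \<in> I" if "a \<in> carrier R" "x \<in> I" for a x
    using that f(1,2) I by (simp add: R.m_assoc)
  have Ia: "x \<oplus>\<^bsub>R\<^esub> y \<in> I" if "x \<in> I" "y \<in> I" for x y using that f(1,2) I by (simp add: R.l_distr)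
  have te: "t (a \<otimes>\<^bsub>R\<^esub> e) \<in> I" if "a \<in> carrier R" for a using t De that by auto
  have te_c: "t (a \<otimes>\<^bsub>R\<^esub> e) \<in> carrier R" if "a \<in> carrier R" for a using te that Ic by auto
  have te_add: "t ((a \<oplus>\<^bsub>R\<^esub> b) \<otimes>\<^bsub>R\<^esub> e) = t (a \<otimes>\<^bsub>R\<^esub> e) \<oplus>\<^bsub>R\<^esub> t (b \<otimes>\<^bsub>R\<^esub> e)"
    if "a \<in> carrier R" "b \<in> carrier R" for a b using that t(3) De e(1) by (simp add: R.l_distr)
  have te_mult: "t ((a \<otimes>\<^bsub>R\<^esub> b) \<otimes>\<^bsub>R\<^esub> e) = t (a \<otimes>\<^bsub>R\<^esub> e) \<otimes>\<^bsub>R\<^esub> t (b \<otimes>\<^bsub>R\<^esub> e)"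
    if ab: "a \<in> carrier R" "b \<in> carrier R" for a b
  proof -
    have "(a \<otimes>\<^bsub>R\<^esub> e) \<otimes>\<^bsub>R\<^esub> (b \<otimes>\<^bsub>R\<^esub> e) = a \<otimes>\<^bsub>R\<^esub> (e \<otimes>\<^bsub>R\<^esub> b) \<otimes>\<^bsub>R\<^esub> e" using ab e(1) by (simp add: R.m_assoc)
    also have "\<dots> = a \<otimes>\<^bsub>R\<^esub> b \<otimes>\<^bsub>R\<^esub> (e \<otimes>\<^bsub>R\<^esub> e)" using ab e(1) unfolding e(3)[OF ab(2)] by (simp add: R.m_assoc)
    finally show ?thesis using t(2)[OF De[OF ab(1)] De[OF ab(2)]] e(2) by simp
  qed
  have te_one: "x \<otimes>\<^bsub>R\<^esub> t (\<one>\<^bsub>R\<^esub> \<otimes>\<^bsub>R\<^esub> e) = x" if "x \<in> I" for x using that t(4) I e(1) by simp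
  have P: "carrier ?P = I" "add ?P = add R" "zero ?P = zero R" "smult ?P = mult R"
    "rsmult ?P = (\<lambda>m a. m \<otimes>\<^bsub>R\<^esub> t (a \<otimes>\<^bsub>R\<^esub> e))"
    by (simp_all add: twisted_bimod_def sub_bimod_def defs)
  have ab: "abelian_group ?P"
  proof (rule abelian_groupI)
    show "\<exists>y\<in>carrier ?P. y \<oplus>\<^bsub>?P\<^esub> x = \<zero>\<^bsub>?P\<^esub>" if "x \<in> carrier ?P" for x
      using that f(1,2) R.l_neg[of x]
      by (intro bexI[of _ "\<ominus>\<^bsub>R\<^esub> x"]) (auto simp: P I R.l_minus)
    show "x \<oplus>\<^bsub>?P\<^esub> y = y \<oplus>\<^bsub>?P\<^esub> x" if "x \<in> carrier ?P" "y \<in> carrier ?P" for x y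
      using that R.a_comm Ic by (simp add: P)
    show "\<zero>\<^bsub>?P\<^esub> \<in> carrier ?P" using f(1,2) by (simp add: P I)
  qed (use f(1,2) in \<open>auto simp: P Ia Ic R.a_assoc\<close>)
  have bim: "bimodule R ?P"
    by (intro bimodule.intro bimodule_axioms.intro ab R.ring_axioms)
      (auto simp: P te_one te_add te_mult te te_c Im Ic R.l_distr R.r_distr R.m_assoc)
  have x0: "x (0::nat) \<in> carrier R" if "x \<in> {..<1} \<rightarrow>\<^sub>E carrier R" for x
    using that by (rule PiE_mem) simp
  let ?i = "\<lambda>x. \<lambda>i\<in>{..<1::nat}. x" and ?p = "\<lambda>r. r (0::nat) \<otimes>\<^bsub>R\<^esub> f"
  have 1: "left_fg_projective R ?P"
    unfolding left_fg_projective_def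
  proof (rule exI[of _ 1], rule bexI[of _ ?i], rule bexI[of _ ?p], rule ballI)
    show "?p (?i x) = x" if "x \<in> carrier ?P" for x using that by (simp add: P I)
    show "?i \<in> left_hom R ?P (free_bimod R 1)"
      by (auto simp: left_hom_def free_bimod_def P Ic intro!: restrict_ext)
    show "?p \<in> left_hom R (free_bimod R 1) ?P"
      unfolding left_hom_def
      using f(1) x0 by (auto simp: free_bimod_def P If R.l_distr R.m_assoc)
  qed
  have kadd: "k (x \<oplus>\<^bsub>R\<^esub> y) = k x \<oplus>\<^bsub>R\<^esub> k y" if xy: "x \<in> I" "y \<in> I" for x y
  proof (rule kt)
    show "k x \<oplus>\<^bsub>R\<^esub> k y \<in> D" using k(1)[OF xy(1)] k(1)[OF xy(2)] e(1) by (simp add: D R.l_distr)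
    show "t (k x \<oplus>\<^bsub>R\<^esub> k y) = x \<oplus>\<^bsub>R\<^esub> y" using t(3) k xy by simp
  qed
  have kmult: "k (x \<otimes>\<^bsub>R\<^esub> t (a \<otimes>\<^bsub>R\<^esub> e)) = k x \<otimes>\<^bsub>R\<^esub> a" if x: "x \<in> I" and a: "a \<in> carrier R" for x a
  proof (rule kt)
    have kx: "k x \<in> carrier R" "k x \<otimes>\<^bsub>R\<^esub> e = k x" using k(1)[OF x] D by auto
    have *: "(k x \<otimes>\<^bsub>R\<^esub> a) \<otimes>\<^bsub>R\<^esub> e = k x \<otimes>\<^bsub>R\<^esub> a"
      using kx a e(1) e(3)[OF a] by (metis R.m_assoc)
    then show "k x \<otimes>\<^bsub>R\<^esub> a \<in> D" using kx a by (simp add: D)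
    show "t (k x \<otimes>\<^bsub>R\<^esub> a) = x \<otimes>\<^bsub>R\<^esub> t (a \<otimes>\<^bsub>R\<^esub> e)"
      using te_mult[OF kx(1) a] * kx(2) k(2)[OF x] by simp
  qed
  let ?i = "\<lambda>x. \<lambda>i\<in>{..<1::nat}. k x" and ?p = "\<lambda>r. t (r (0::nat) \<otimes>\<^bsub>R\<^esub> e)"
  have 2: "right_fg_projective R ?P"
    unfolding right_fg_projective_def
  proof (rule exI[of _ 1], rule bexI[of _ ?i], rule bexI[of _ ?p], rule ballI)
    show "?p (?i x) = x" if "x \<in> carrier ?P" for x
      using that k[of x] by (simp add: P D)
    show "?i \<in> right_hom R ?P (free_bimod R 1)"
      using k(1) Dc by (auto simp: right_hom_def free_bimod_def P kadd kmult intro!: restrict_ext)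
    show "?p \<in> right_hom R (free_bimod R 1) ?P"
      unfolding right_hom_def
      using x0 by (auto simp: free_bimod_def P te te_add te_mult)
  qed
  have 3: "\<exists>c \<in> carrier R. \<forall>x \<in> carrier ?P. h x = c \<odot>\<^bsub>?P\<^esub> x" if h: "h \<in> right_hom R ?P ?P" for h
  proof (intro bexI ballI)
    show "h f \<in> carrier R" using right_homD(1)[OF h, of f] fI Ic by (simp add: P)
    fix x assume "x \<in> carrier ?P"
    then have x: "x \<in> I" by (simp add: P)
    have kx: "k x \<in> carrier R" "k x \<otimes>\<^bsub>R\<^esub> e = k x" using k(1)[OF x] D by auto
    have "h (f \<otimes>\<^bsub>R\<^esub> x) = h f \<otimes>\<^bsub>R\<^esub> x"
      using right_homD(3)[OF h, of "k x" f] kx fI k(2)[OF x] by (simp add: P)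
    moreover have "f \<otimes>\<^bsub>R\<^esub> x = x" using f(3) x I by simp
    ultimately show "h x = h f \<odot>\<^bsub>?P\<^esub> x" by (simp add: P)
  qed
  have 4: "\<exists>c \<in> carrier R. \<forall>x \<in> carrier ?P. h x = x \<odot>\<^sub>r\<^bsub>?P\<^esub> c" if h: "h \<in> left_hom R ?P ?P" for h
  proof (intro bexI ballI)
    have hf: "h f \<in> I" using left_homD(1)[OF h, of f] fI by (simp add: P)
    have kh: "k (h f) \<in> carrier R" "k (h f) \<otimes>\<^bsub>R\<^esub> e = k (h f)" using k(1)[OF hf] D by auto
    then show "k (h f) \<in> carrier R" by simp
    fix x assume "x \<in> carrier ?P"
    then have x: "x \<in> carrier R" "x \<otimes>\<^bsub>R\<^esub> f = x" using I by (auto simp: P)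
    have "h (x \<otimes>\<^bsub>R\<^esub> f) = x \<otimes>\<^bsub>R\<^esub> h f"
      using left_homD(3)[OF h, of x f] x fI by (simp add: P)
    then show "h x = x \<odot>\<^sub>r\<^bsub>?P\<^esub> k (h f)" using kh k(2)[OF hf] x by (simp add: P)
  qed
  show ?thesis unfolding partially_invertible_def using bim 1 2 3 4 by blast
qed

text \<open>The map \<^const>\<open>omega\<close> takes its values in \<^const>\<open>PicS\<close>.\<close>

lemma omega_in_PicS: "ring R \<Longrightarrow> \<theta> \<in> I_u R \<Longrightarrow> omega R \<theta> \<in> PicS R"
  unfolding omega_def by (intro bimod_class_PicS twisted_partially_invertible)

end

(* The key step is that a left R-linear map f : A_g -> R is right multiplication by the element
   v = sum_i b_i f(a_i) of A_(g^-1), where epsilon_(g^-1) = sum_i b_i a_i with b_i in A_(g^-1) and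
   a_i in A_g. If f is an isomorphism onto R epsilon_g and f(s) = epsilon_g, then s v = epsilon_g,
   and v s = epsilon_(g^-1) because v s fixes every element of A_g under right multiplication.
   Conversely an epsilon-invertible s with inverse b gives the isomorphism x |-> x b and the
   twist theta(r) = s r b.
   For the global equivalences, an isomorphism of A_g with any twisted bimodule forces
   1_theta = epsilon_g, as both idempotents act as left identities on A_g. *)

theory Submission
  imports Defs
begin

context epsilon_strongly_graded_ring begin

section \<open>Closure properties of the components and centrality of the idempotents
  \<open>eps g\<close>\<close>

lemma gr_one_carrier: "r \<in> gr \<one>\<^bsub>G\<^esub> \<Longrightarrow> r \<in> carrier A"
  using gr_carrier[of "\<one>\<^bsub>G\<^esub>"] by simp

lemma gr_lsmult: "g \<in> carrier G \<Longrightarrow> r \<in> gr \<one>\<^bsub>G\<^esub> \<Longrightarrow> x \<in> gr g \<Longrightarrow> r \<otimes>\<^bsub>A\<^esub> x \<in> gr g"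
  using gr_mult[of "\<one>\<^bsub>G\<^esub>" g r x] by simp

lemma gr_rsmult: "g \<in> carrier G \<Longrightarrow> r \<in> gr \<one>\<^bsub>G\<^esub> \<Longrightarrow> x \<in> gr g \<Longrightarrow> x \<otimes>\<^bsub>A\<^esub> r \<in> gr g"
  using gr_mult[of g "\<one>\<^bsub>G\<^esub>" x r] by simp

lemma gr_mult_inv:
  assumes "g \<in> carrier G" "x \<in> gr g" "y \<in> gr (inv\<^bsub>G\<^esub> g)"
  shows "x \<otimes>\<^bsub>A\<^esub> y \<in> gr \<one>\<^bsub>G\<^esub>" "y \<otimes>\<^bsub>A\<^esub> x \<in> gr \<one>\<^bsub>G\<^esub>"
  using gr_mult[of g "inv\<^bsub>G\<^esub> g" x y] gr_mult[of "inv\<^bsub>G\<^esub> g" g y x] assms by simp_all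

lemma gr_add: "g \<in> carrier G \<Longrightarrow> x \<in> gr g \<Longrightarrow> y \<in> gr g \<Longrightarrow> x \<oplus>\<^bsub>A\<^esub> y \<in> gr g"
  using gr_subgroup additive_subgroup.a_closed by metis

lemma gr_zero: "g \<in> carrier G \<Longrightarrow> \<zero>\<^bsub>A\<^esub> \<in> gr g"
  using gr_subgroup additive_subgroup.zero_closed by metis

lemma epsilon_carrier: "g \<in> carrier G \<Longrightarrow> eps g \<in> carrier A"
  using epsilon_gr_one gr_one_carrier by blast

lemma epsilon_left_inv: "g \<in> carrier G \<Longrightarrow> y \<in> gr (inv\<^bsub>G\<^esub> g) \<Longrightarrow> eps (inv\<^bsub>G\<^esub> g) \<otimes>\<^bsub>A\<^esub> y = y"
  using epsilon_left by simp

lemma epsilon_right_inv: "g \<in> carrier G \<Longrightarrow> y \<in> gr (inv\<^bsub>G\<^esub> g) \<Longrightarrow> y \<otimes>\<^bsub>A\<^esub> eps g = y"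
  using epsilon_right[of "inv\<^bsub>G\<^esub> g" y] by simp

lemma epsilon_inv_prod: "g \<in> carrier G \<Longrightarrow> eps (inv\<^bsub>G\<^esub> g) \<in> gr (inv\<^bsub>G\<^esub> g) \<cdot>\<^bsub>A\<^esub> gr g"
  using epsilon_prod[of "inv\<^bsub>G\<^esub> g"] by simp

text \<open>Since \<open>eps g\<close> is a finite sum of products with left factors in A_g,
  anything fixing A_g from the left fixes \<open>eps g\<close> too. This turns statements about the
  action on A_g into equations between elements of R.\<close>

lemma left_unit_epsilon:
  assumes g: "g \<in> carrier G" and e: "e \<in> carrier A" "\<And>x. x \<in> gr g \<Longrightarrow> e \<otimes>\<^bsub>A\<^esub> x = x"
  shows "e \<otimes>\<^bsub>A\<^esub> eps g = eps g"
  using gr_prod_left_unit[OF g _ e epsilon_prod[OF g]] g by simp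

lemma right_unit_epsilon:
  assumes g: "g \<in> carrier G" and e: "e \<in> carrier A" "\<And>x. x \<in> gr g \<Longrightarrow> x \<otimes>\<^bsub>A\<^esub> e = x"
  shows "eps (inv\<^bsub>G\<^esub> g) \<otimes>\<^bsub>A\<^esub> e = eps (inv\<^bsub>G\<^esub> g)"
  using gr_prod_right_unit[OF _ g e epsilon_inv_prod[OF g]] g by simp

lemma epsilon_idem: "g \<in> carrier G \<Longrightarrow> eps g \<otimes>\<^bsub>A\<^esub> eps g = eps g"
  by (rule left_unit_epsilon) (auto intro: epsilon_carrier epsilon_left)

text \<open>R can be absorbed into the left factor of each product. For h = g^-1 this and its mirror
  image make A_g A_(g^-1) stable under R on both sides, which is what centrality of
  \<open>eps g\<close> rests on.\<close>

lemma gr_prod_lsmult: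
  assumes gh: "g \<in> carrier G" "h \<in> carrier G" and r: "r \<in> gr \<one>\<^bsub>G\<^esub>" and z: "z \<in> gr g \<cdot>\<^bsub>A\<^esub> gr h"
  shows "z \<in> carrier A \<and> r \<otimes>\<^bsub>A\<^esub> z \<in> gr g \<cdot>\<^bsub>A\<^esub> gr h"
  using z
proof induction
  case (prod i j)
  have c: "i \<in> carrier A" "j \<in> carrier A" "r \<in> carrier A"
    using prod gh gr_carrier gr_one_carrier r by auto
  then show ?case
    using ideal_prod.prod[OF gr_lsmult[OF gh(1) r prod(1)] prod(2), where R = A] by (simp add: A.m_assoc)
next
  case (sum s t)
  then show ?case using gr_one_carrier[OF r] by (simp add: A.r_distr ideal_prod.sum)
qed

lemma gr_prod_rsmult:
  assumes gh: "g \<in> carrier G" "h \<in> carrier G" and r: "r \<in> gr \<one>\<^bsub>G\<^esub>" and z: "z \<in> gr g \<cdot>\<^bsub>A\<^esub> gr h"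
  shows "z \<in> carrier A \<and> z \<otimes>\<^bsub>A\<^esub> r \<in> gr g \<cdot>\<^bsub>A\<^esub> gr h"
  using z
proof induction
  case (prod i j)
  have c: "i \<in> carrier A" "j \<in> carrier A" "r \<in> carrier A"
    using prod gh gr_carrier gr_one_carrier r by auto
  then show ?case
    using ideal_prod.prod[OF prod(1) gr_rsmult[OF gh(2) r prod(2)], where R = A] by (simp add: A.m_assoc)
next
  case (sum s t)
  then show ?case using gr_one_carrier[OF r] by (simp add: A.l_distr ideal_prod.sum)
qed

text \<open>Both \<open>eps g\<close> r and r \<open>eps g\<close> lie in A_g A_(g^-1), on which
  \<open>eps g\<close> is a two-sided identity; hence both equal \<open>eps g\<close> r
  \<open>eps g\<close>.\<close>

lemma epsilon_central:
  assumes g: "g \<in> carrier G" and r: "r \<in> gr \<one>\<^bsub>G\<^esub>"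
  shows "eps g \<otimes>\<^bsub>A\<^esub> r = r \<otimes>\<^bsub>A\<^esub> eps g"
proof -
  let ?h = "inv\<^bsub>G\<^esub> g"
  have h: "?h \<in> carrier G" using g by simp
  have c: "eps g \<in> carrier A" "r \<in> carrier A" using epsilon_carrier[OF g] gr_one_carrier[OF r] .
  have "r \<otimes>\<^bsub>A\<^esub> eps g = eps g \<otimes>\<^bsub>A\<^esub> (r \<otimes>\<^bsub>A\<^esub> eps g)"
    using gr_prod_left_unit[OF g h c(1) epsilon_left[OF g]] gr_prod_lsmult[OF g h r epsilon_prod[OF g]]
    by simp
  also have "\<dots> = (eps g \<otimes>\<^bsub>A\<^esub> r) \<otimes>\<^bsub>A\<^esub> eps g" using c by (simp add: A.m_assoc)
  also have "\<dots> = eps g \<otimes>\<^bsub>A\<^esub> r"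
    using gr_prod_right_unit[OF g h c(1) epsilon_right_inv[OF g]]
      gr_prod_rsmult[OF g h r epsilon_prod[OF g]] by simp
  finally show ?thesis by simp
qed

lemma epsilon_central_idempotent: "g \<in> carrier G \<Longrightarrow> eps g \<in> central_idempotents R"
  unfolding central_idempotents_def mem_Collect_eq
  by (intro conjI ballI) (unfold principal_component_def, simp_all add: epsilon_gr_one epsilon_idem,
      rule epsilon_central)

text \<open>Right multiplication by an idempotent e is a projection of R onto the principal ideal,
  so membership becomes a fixed-point equation that can be checked by computation.\<close>

lemma mem_PIdl_idempotent:
  assumes e: "e \<in> gr \<one>\<^bsub>G\<^esub>" "e \<otimes>\<^bsub>A\<^esub> e = e"
  shows "x \<in> PIdl\<^bsub>R\<^esub> e \<longleftrightarrow> x \<in> gr \<one>\<^bsub>G\<^esub> \<and> x \<otimes>\<^bsub>A\<^esub> e = x"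
proof
  have c: "e \<in> carrier A" by (rule gr_one_carrier[OF e(1)])
  assume "x \<in> PIdl\<^bsub>R\<^esub> e"
  then obtain y where y: "y \<in> gr \<one>\<^bsub>G\<^esub>" "x = y \<otimes>\<^bsub>A\<^esub> e"
    by (auto simp: cgenideal_def principal_component_def)
  then show "x \<in> gr \<one>\<^bsub>G\<^esub> \<and> x \<otimes>\<^bsub>A\<^esub> e = x"
    using gr_rsmult[OF G.one_closed e(1) y(1)] gr_one_carrier[OF y(1)] c e(2) by (simp add: A.m_assoc)
next
  assume x: "x \<in> gr \<one>\<^bsub>G\<^esub> \<and> x \<otimes>\<^bsub>A\<^esub> e = x"
  then have "x = x \<otimes>\<^bsub>R\<^esub> e" "x \<in> carrier R" by (simp_all add: principal_component_def)
  then show "x \<in> PIdl\<^bsub>R\<^esub> e" unfolding cgenideal_def by blast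
qed

lemmas mem_PIdl_epsilon = mem_PIdl_idempotent[OF epsilon_gr_one epsilon_idem]

lemma epsilon_mem_PIdl: "g \<in> carrier G \<Longrightarrow> eps g \<in> PIdl\<^bsub>R\<^esub> (eps g)"
  by (simp add: mem_PIdl_epsilon epsilon_gr_one epsilon_idem)

section \<open>One-sided inverses relative to the idempotents\<close>

text \<open>The usual cancellation v = v(su) = (vs)u = u survives because \<open>eps g\<close> is a
  right identity and the idempotent of g^-1 a left identity on A_(g^-1).\<close>

lemma one_sided_inverses_eq:
  assumes g: "g \<in> carrier G" and s: "s \<in> gr g" and u: "u \<in> gr (inv\<^bsub>G\<^esub> g)" and v: "v \<in> gr (inv\<^bsub>G\<^esub> g)"
    and su: "s \<otimes>\<^bsub>A\<^esub> u = eps g" and vs: "v \<otimes>\<^bsub>A\<^esub> s = eps (inv\<^bsub>G\<^esub> g)"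
  shows "u = v"
proof -
  have c: "s \<in> carrier A" "u \<in> carrier A" "v \<in> carrier A"
    using gr_carrier[OF g s] gr_carrier[OF G.inv_closed[OF g]] u v by auto
  have "v = v \<otimes>\<^bsub>A\<^esub> (s \<otimes>\<^bsub>A\<^esub> u)" using epsilon_right_inv[OF g v] su by simp
  also have "\<dots> = u" using c vs epsilon_left_inv[OF g u] by (simp flip: A.m_assoc)
  finally show ?thesis by simp
qed

lemma epsilon_invertibleI:
  assumes "g \<in> carrier G" "s \<in> gr g" "u \<in> gr (inv\<^bsub>G\<^esub> g)" "v \<in> gr (inv\<^bsub>G\<^esub> g)"
    "s \<otimes>\<^bsub>A\<^esub> u = eps g" "v \<otimes>\<^bsub>A\<^esub> s = eps (inv\<^bsub>G\<^esub> g)"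
  shows "epsilon_invertible G A gr g s"
  using assms one_sided_inverses_eq[OF assms] unfolding epsilon_invertible_def by blast

section \<open>From a left isomorphism to an epsilon-invertible element\<close>

lemma left_hom_eq_right_mult:
  assumes g: "g \<in> carrier G" and f: "\<And>x. x \<in> gr g \<Longrightarrow> f x \<in> gr \<one>\<^bsub>G\<^esub>"
    and add: "\<And>x y. x \<in> gr g \<Longrightarrow> y \<in> gr g \<Longrightarrow> f (x \<oplus>\<^bsub>A\<^esub> y) = f x \<oplus>\<^bsub>A\<^esub> f y"
    and lin: "\<And>r x. r \<in> gr \<one>\<^bsub>G\<^esub> \<Longrightarrow> x \<in> gr g \<Longrightarrow> f (r \<otimes>\<^bsub>A\<^esub> x) = r \<otimes>\<^bsub>A\<^esub> f x"
  obtains v where "v \<in> gr (inv\<^bsub>G\<^esub> g)" "\<And>x. x \<in> gr g \<Longrightarrow> f x = x \<otimes>\<^bsub>A\<^esub> v"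
proof -
  let ?h = "inv\<^bsub>G\<^esub> g"
  have h: "?h \<in> carrier G" using g by simp
  \<comment> \<open>Induction over A_(g^-1) A_g takes the place of an explicit decomposition of the
    idempotent: every z there has a v with f(xz) = xv. Membership of z in R is carried along so that
    x z1 and x z2 stay in A_g, where f is additive.\<close>
  have "z \<in> gr \<one>\<^bsub>G\<^esub> \<and> (\<exists>v\<in>gr ?h. \<forall>x\<in>gr g. f (x \<otimes>\<^bsub>A\<^esub> z) = x \<otimes>\<^bsub>A\<^esub> v)" if "z \<in> gr ?h \<cdot>\<^bsub>A\<^esub> gr g" for z
    using that
  proof induction
    case (prod b a)
    have c: "b \<in> carrier A" "a \<in> carrier A" "f a \<in> carrier A"
      using gr_carrier[OF h prod(1)] gr_carrier[OF g prod(2)] gr_one_carrier[OF f[OF prod(2)]] .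
    \<comment> \<open>The product xb lies in R, so linearity gives f((xb)a) = (xb) f(a); the element
      b f(a) is therefore the required v.\<close>
    have "f (x \<otimes>\<^bsub>A\<^esub> (b \<otimes>\<^bsub>A\<^esub> a)) = x \<otimes>\<^bsub>A\<^esub> (b \<otimes>\<^bsub>A\<^esub> f a)" if x: "x \<in> gr g" for x
      using lin[OF gr_mult_inv(1)[OF g x prod(1)] prod(2)] c gr_carrier[OF g x] by (simp add: A.m_assoc)
    then show ?case using gr_mult_inv(2)[OF g prod(2,1)] gr_rsmult[OF h f[OF prod(2)] prod(1)] by blast
  next
    case (sum z1 z2)
    then obtain v1 v2 where v: "v1 \<in> gr ?h" "v2 \<in> gr ?h"
      "\<forall>x\<in>gr g. f (x \<otimes>\<^bsub>A\<^esub> z1) = x \<otimes>\<^bsub>A\<^esub> v1" "\<forall>x\<in>gr g. f (x \<otimes>\<^bsub>A\<^esub> z2) = x \<otimes>\<^bsub>A\<^esub> v2" by blast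
    have z: "z1 \<in> gr \<one>\<^bsub>G\<^esub>" "z2 \<in> gr \<one>\<^bsub>G\<^esub>" using sum by auto
    have "f (x \<otimes>\<^bsub>A\<^esub> (z1 \<oplus>\<^bsub>A\<^esub> z2)) = x \<otimes>\<^bsub>A\<^esub> (v1 \<oplus>\<^bsub>A\<^esub> v2)" if x: "x \<in> gr g" for x
      using add[OF gr_rsmult[OF g z(1) x] gr_rsmult[OF g z(2) x]] v x z gr_one_carrier gr_carrier[OF g x]
        gr_carrier[OF h] by (simp add: A.r_distr)
    then show ?case using gr_add[OF h v(1,2)] gr_add[OF _ z] by blast
  qed
  from this[OF epsilon_inv_prod[OF g]]
  obtain v where "v \<in> gr ?h" "\<forall>x\<in>gr g. f (x \<otimes>\<^bsub>A\<^esub> eps ?h) = x \<otimes>\<^bsub>A\<^esub> v" by blast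
  then show thesis using that epsilon_right[OF g] by simp
qed

lemma left_isomorphic_imp_epsilon_invertible:
  assumes g: "g \<in> carrier G"
    and iso: "left_isomorphic R (sub_bimod A (gr g)) (sub_bimod A (PIdl\<^bsub>R\<^esub> (eps g)))"
  obtains s where "s \<in> gr g" "epsilon_invertible G A gr g s"
proof -
  let ?h = "inv\<^bsub>G\<^esub> g"
  have h: "?h \<in> carrier G" using g by simp
  obtain f where f: "f \<in> left_hom R (sub_bimod A (gr g)) (sub_bimod A (PIdl\<^bsub>R\<^esub> (eps g)))"
    and bij: "bij_betw f (gr g) (PIdl\<^bsub>R\<^esub> (eps g))"
    using iso by (auto simp: left_isomorphic_def sub_bimod_def)
  have f1: "f x \<in> gr \<one>\<^bsub>G\<^esub>" "f x \<otimes>\<^bsub>A\<^esub> eps g = f x" if "x \<in> gr g" for x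
    using bij_betwE[OF bij] that by (auto simp: mem_PIdl_epsilon g)
  have lin: "f (r \<otimes>\<^bsub>A\<^esub> x) = r \<otimes>\<^bsub>A\<^esub> f x" if "r \<in> gr \<one>\<^bsub>G\<^esub>" "x \<in> gr g" for r x
    using left_homD(3)[OF f] that by (simp add: sub_bimod_def principal_component_def)
  have add: "f (x \<oplus>\<^bsub>A\<^esub> y) = f x \<oplus>\<^bsub>A\<^esub> f y" if "x \<in> gr g" "y \<in> gr g" for x y
    using left_homD(2)[OF f] that by (simp add: sub_bimod_def)
  obtain v where v: "v \<in> gr ?h" "\<And>x. x \<in> gr g \<Longrightarrow> f x = x \<otimes>\<^bsub>A\<^esub> v"
    using left_hom_eq_right_mult[OF g f1(1) add lin] by blast
  obtain s where s: "s \<in> gr g" "f s = eps g"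
    using bij epsilon_mem_PIdl[OF g] unfolding bij_betw_def by (metis imageE)
  have c: "s \<in> carrier A" "v \<in> carrier A" using gr_carrier[OF g s(1)] gr_carrier[OF h v(1)] .
  have "x \<otimes>\<^bsub>A\<^esub> (v \<otimes>\<^bsub>A\<^esub> s) = x" if x: "x \<in> gr g" for x
  proof -
    \<comment> \<open>Linearity gives f(f(x) s) = f(x) f(s) = f(x) \<open>eps g\<close> = f(x).
      Injectivity then yields f(x) s = x, that is, x v s = x.\<close>
    have "f (f x \<otimes>\<^bsub>A\<^esub> s) = f x" using lin f1 s x by simp
    then have "f x \<otimes>\<^bsub>A\<^esub> s = x"
      using bij gr_lsmult[OF g f1(1)[OF x] s(1)] x by (metis bij_betw_imp_inj_on inj_onD)
    then show ?thesis using v(2)[OF x] c gr_carrier[OF g x] by (simp add: A.m_assoc)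
  qed
  \<comment> \<open>The idempotent \<open>eps ?h\<close> is a sum of products with right factors in
    A_g, and each of these is fixed by v s on the right.\<close>
  then have "eps ?h \<otimes>\<^bsub>A\<^esub> (v \<otimes>\<^bsub>A\<^esub> s) = eps ?h" using right_unit_epsilon[OF g] c by simp
  moreover have "eps ?h \<otimes>\<^bsub>A\<^esub> (v \<otimes>\<^bsub>A\<^esub> s) = v \<otimes>\<^bsub>A\<^esub> s"
    using c epsilon_carrier[OF h] epsilon_left[OF h v(1)] by (simp flip: A.m_assoc)
  ultimately have "v \<otimes>\<^bsub>A\<^esub> s = eps ?h" by simp
  moreover have "s \<otimes>\<^bsub>A\<^esub> v = eps g" using v(2) s by simp
  ultimately show thesis using that s(1) epsilon_invertibleI[OF g s(1) v(1) v(1)] by blast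
qed

section \<open>From an epsilon-invertible element to a twisted bimodule\<close>

text \<open>With b the inverse of s, the map from x to xb has inverse r to rs and is left linear by
  associativity. It carries the right action to a twisted one because x r b = (xb)(s r b), the
  factor bs being absorbed by x.\<close>

lemma epsilon_invertible_imp_bimod_isomorphic:
  assumes g: "g \<in> carrier G" and inv: "epsilon_invertible G A gr g s"
  obtains \<theta> where "\<theta> \<in> I_u R" "dom_one \<theta> = eps (inv\<^bsub>G\<^esub> g)" "im_one \<theta> = eps g"
    "bimod_isomorphic R (sub_bimod A (gr g)) (twisted_bimod R \<theta>)"
proof -
  let ?h = "inv\<^bsub>G\<^esub> g"
  have h: "?h \<in> carrier G" using g by simp
  obtain b where s: "s \<in> gr g" and b: "b \<in> gr ?h" and sb: "s \<otimes>\<^bsub>A\<^esub> b = eps g" and bs: "b \<otimes>\<^bsub>A\<^esub> s = eps ?h"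
    using inv unfolding epsilon_invertible_def by blast
  \<comment> \<open>Conjugation by s is cut down to the ideal of \<open>eps ?h\<close>, as
    \<open>I_u\<close> asks for maps extensional on their domain.\<close>
  define t where "t = restrict (\<lambda>r. s \<otimes>\<^bsub>A\<^esub> r \<otimes>\<^bsub>A\<^esub> b) (PIdl\<^bsub>R\<^esub> (eps ?h))"
  define \<theta> where "\<theta> = \<lparr>dom_one = eps ?h, im_one = eps g, iso_map = t\<rparr>"
  note c1 = gr_one_carrier and cs = gr_carrier[OF g s] and cb = gr_carrier[OF h b]
  note ce = epsilon_carrier[OF g] and ch = epsilon_carrier[OF h]
  have D: "x \<in> PIdl\<^bsub>R\<^esub> (eps ?h) \<longleftrightarrow> x \<in> gr \<one>\<^bsub>G\<^esub> \<and> x \<otimes>\<^bsub>A\<^esub> eps ?h = x" for x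
    by (rule mem_PIdl_epsilon[OF h h])
  have I: "x \<in> PIdl\<^bsub>R\<^esub> (eps g) \<longleftrightarrow> x \<in> gr \<one>\<^bsub>G\<^esub> \<and> x \<otimes>\<^bsub>A\<^esub> eps g = x" for x
    by (rule mem_PIdl_epsilon[OF g g])
  have be: "b \<otimes>\<^bsub>A\<^esub> eps g = b" by (rule epsilon_right_inv[OF g b])
  have eb: "eps ?h \<otimes>\<^bsub>A\<^esub> b = b" by (rule epsilon_left[OF h b])
  have t_eq: "t r = s \<otimes>\<^bsub>A\<^esub> r \<otimes>\<^bsub>A\<^esub> b" if "r \<in> PIdl\<^bsub>R\<^esub> (eps ?h)" for r
    using that by (simp add: t_def)
  have xb: "x \<otimes>\<^bsub>A\<^esub> b \<in> PIdl\<^bsub>R\<^esub> (eps g)" if x: "x \<in> gr g" for x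
    using gr_mult_inv(1)[OF g x b] gr_carrier[OF g x] cb ce be by (simp add: I A.m_assoc)
  \<comment> \<open>The element bs is a right identity on all of A_g. This cancellation drives the
    multiplicativity of \<open>t\<close> as well as the compatibility with the right action.\<close>
  have xbs: "x \<otimes>\<^bsub>A\<^esub> b \<otimes>\<^bsub>A\<^esub> s = x" if x: "x \<in> gr g" for x
    using epsilon_right[OF g x] gr_carrier[OF g x] cb cs bs by (simp add: A.m_assoc)
  have rsb: "r \<otimes>\<^bsub>A\<^esub> s \<otimes>\<^bsub>A\<^esub> b = r" if r: "r \<in> PIdl\<^bsub>R\<^esub> (eps g)" for r
    using r c1 cs cb sb by (simp add: A.m_assoc I)
  have tI: "t r \<in> PIdl\<^bsub>R\<^esub> (eps g)" if r: "r \<in> PIdl\<^bsub>R\<^esub> (eps ?h)" for r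
    using xb[OF gr_rsmult[OF g _ s]] r by (simp add: t_eq D)
  have tmult: "t (x \<otimes>\<^bsub>A\<^esub> y) = t x \<otimes>\<^bsub>A\<^esub> t y"
    if x: "x \<in> PIdl\<^bsub>R\<^esub> (eps ?h)" and y: "y \<in> PIdl\<^bsub>R\<^esub> (eps ?h)" for x y
  proof -
    have cx: "x \<in> carrier A" "y \<in> carrier A" "x \<in> gr \<one>\<^bsub>G\<^esub>" "y \<in> gr \<one>\<^bsub>G\<^esub>" using x y D c1 by auto
    have xy: "x \<otimes>\<^bsub>A\<^esub> y \<in> PIdl\<^bsub>R\<^esub> (eps ?h)"
      using cx y gr_lsmult[of "\<one>\<^bsub>G\<^esub>" x y] ch by (simp add: D A.m_assoc)
    \<comment> \<open>Regrouped so that the inner b s stands directly after s x, an element of A_g,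
      and can be cancelled.\<close>
    have "t x \<otimes>\<^bsub>A\<^esub> t y = (s \<otimes>\<^bsub>A\<^esub> x) \<otimes>\<^bsub>A\<^esub> b \<otimes>\<^bsub>A\<^esub> s \<otimes>\<^bsub>A\<^esub> (y \<otimes>\<^bsub>A\<^esub> b)"
      using cx cs cb by (simp add: t_eq x y A.m_assoc)
    also have "\<dots> = t (x \<otimes>\<^bsub>A\<^esub> y)"
      unfolding xbs[OF gr_rsmult[OF g cx(3) s]] using cx cs cb by (simp add: t_eq xy A.m_assoc)
    finally show ?thesis by simp
  qed
  have tadd: "t (x \<oplus>\<^bsub>A\<^esub> y) = t x \<oplus>\<^bsub>A\<^esub> t y"
    if x: "x \<in> PIdl\<^bsub>R\<^esub> (eps ?h)" and y: "y \<in> PIdl\<^bsub>R\<^esub> (eps ?h)" for x y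
  proof -
    have cx: "x \<in> carrier A" "y \<in> carrier A" "x \<in> gr \<one>\<^bsub>G\<^esub>" "y \<in> gr \<one>\<^bsub>G\<^esub>" using x y D c1 by auto
    have xy: "x \<oplus>\<^bsub>A\<^esub> y \<in> PIdl\<^bsub>R\<^esub> (eps ?h)"
      using cx x y gr_add[of "\<one>\<^bsub>G\<^esub>" x y] ch by (simp add: D A.l_distr)
    show ?thesis using cx cs cb by (simp add: t_eq x y xy A.l_distr A.r_distr)
  qed
  have tone: "t (eps ?h) = eps g"
    using epsilon_right[OF g s] sb by (simp add: t_eq epsilon_mem_PIdl h)
  have bys: "b \<otimes>\<^bsub>A\<^esub> y \<otimes>\<^bsub>A\<^esub> s \<in> PIdl\<^bsub>R\<^esub> (eps ?h)" if y: "y \<in> PIdl\<^bsub>R\<^esub> (eps g)" for y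
    using gr_mult_inv(2)[OF g s gr_rsmult[OF h _ b]] y c1 cb cs ch epsilon_right[OF g s]
    by (simp add: D I A.m_assoc)
  have bij: "bij_betw t (PIdl\<^bsub>R\<^esub> (eps ?h)) (PIdl\<^bsub>R\<^esub> (eps g))"
  proof (rule bij_betw_byWitness[where f' = "\<lambda>y. b \<otimes>\<^bsub>A\<^esub> y \<otimes>\<^bsub>A\<^esub> s"])
    show "\<forall>x\<in>PIdl\<^bsub>R\<^esub> (eps ?h). b \<otimes>\<^bsub>A\<^esub> t x \<otimes>\<^bsub>A\<^esub> s = x"
    proof
      fix x assume x: "x \<in> PIdl\<^bsub>R\<^esub> (eps ?h)"
      have "b \<otimes>\<^bsub>A\<^esub> t x \<otimes>\<^bsub>A\<^esub> s = (b \<otimes>\<^bsub>A\<^esub> s) \<otimes>\<^bsub>A\<^esub> x \<otimes>\<^bsub>A\<^esub> (b \<otimes>\<^bsub>A\<^esub> s)"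
        using x c1 cs cb by (simp add: t_eq D A.m_assoc)
      \<comment> \<open>Centrality of \<open>eps ?h\<close> moves its left copy past x.\<close>
      also have "\<dots> = x \<otimes>\<^bsub>A\<^esub> eps ?h" unfolding bs using epsilon_central[OF h, of x] x by (simp add: D)
      finally show "b \<otimes>\<^bsub>A\<^esub> t x \<otimes>\<^bsub>A\<^esub> s = x" using x by (simp add: D)
    qed
    show "\<forall>y\<in>PIdl\<^bsub>R\<^esub> (eps g). t (b \<otimes>\<^bsub>A\<^esub> y \<otimes>\<^bsub>A\<^esub> s) = y"
    proof
      fix y assume y: "y \<in> PIdl\<^bsub>R\<^esub> (eps g)"
      have "t (b \<otimes>\<^bsub>A\<^esub> y \<otimes>\<^bsub>A\<^esub> s) = (s \<otimes>\<^bsub>A\<^esub> b) \<otimes>\<^bsub>A\<^esub> y \<otimes>\<^bsub>A\<^esub> (s \<otimes>\<^bsub>A\<^esub> b)"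
        unfolding t_eq[OF bys[OF y]] using y c1 cs cb by (simp add: I A.m_assoc)
      also have "\<dots> = y" unfolding sb using epsilon_central[OF g, of y] y by (simp add: I)
      finally show "t (b \<otimes>\<^bsub>A\<^esub> y \<otimes>\<^bsub>A\<^esub> s) = y" .
    qed
  qed (use tI bys in auto)
  have "t \<in> ring_iso (unital_ideal R (eps ?h)) (unital_ideal R (eps g))"
    using tI tmult tadd tone bij
    by (auto simp: ring_iso_def ring_hom_def unital_ideal_def principal_component_def)
  then have \<theta>: "\<theta> \<in> I_u R"
    using epsilon_central_idempotent g h by (simp add: I_u_def \<theta>_def t_def)
  have twist: "x \<otimes>\<^bsub>A\<^esub> r \<otimes>\<^bsub>A\<^esub> b = x \<otimes>\<^bsub>A\<^esub> b \<otimes>\<^bsub>A\<^esub> t (r \<otimes>\<^bsub>A\<^esub> eps ?h)"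
    if x: "x \<in> gr g" and r: "r \<in> gr \<one>\<^bsub>G\<^esub>" for x r
  proof -
    have re: "r \<otimes>\<^bsub>A\<^esub> eps ?h \<in> PIdl\<^bsub>R\<^esub> (eps ?h)"
      using r by (auto simp: cgenideal_def principal_component_def)
    \<comment> \<open>The \<open>eps ?h\<close> inside the argument of \<open>t\<close> is absorbed
      by the b that follows it.\<close>
    have "x \<otimes>\<^bsub>A\<^esub> b \<otimes>\<^bsub>A\<^esub> t (r \<otimes>\<^bsub>A\<^esub> eps ?h) = x \<otimes>\<^bsub>A\<^esub> b \<otimes>\<^bsub>A\<^esub> s \<otimes>\<^bsub>A\<^esub> (r \<otimes>\<^bsub>A\<^esub> b)"
      using gr_carrier[OF g x] c1[OF r] cb cs ch eb by (simp add: t_eq[OF re] A.m_assoc)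
    then show ?thesis using gr_carrier[OF g x] c1[OF r] cb by (simp add: xbs[OF x] A.m_assoc)
  qed
  have bij2: "bij_betw (\<lambda>x. x \<otimes>\<^bsub>A\<^esub> b) (gr g) (PIdl\<^bsub>R\<^esub> (eps g))"
    by (rule bij_betw_byWitness[where f' = "\<lambda>r. r \<otimes>\<^bsub>A\<^esub> s"])
      (use xbs rsb xb gr_lsmult[OF g _ s] I in auto)
  have "bimod_isomorphic R (sub_bimod A (gr g)) (twisted_bimod R \<theta>)"
    unfolding bimod_isomorphic_def
  proof (rule bexI[of _ "\<lambda>x. x \<otimes>\<^bsub>A\<^esub> b"])
    show "bij_betw (\<lambda>x. x \<otimes>\<^bsub>A\<^esub> b) (carrier (sub_bimod A (gr g))) (carrier (twisted_bimod R \<theta>))"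
      using bij2 by (simp add: twisted_bimod_def sub_bimod_def \<theta>_def)
    show "(\<lambda>x. x \<otimes>\<^bsub>A\<^esub> b) \<in> left_hom R (sub_bimod A (gr g)) (twisted_bimod R \<theta>)
        \<inter> right_hom R (sub_bimod A (gr g)) (twisted_bimod R \<theta>)"
      using xb twist gr_carrier[OF g] cb c1
      by (auto simp: left_hom_def right_hom_def twisted_bimod_def sub_bimod_def \<theta>_def
          principal_component_def A.l_distr A.m_assoc)
  qed
  then show thesis using that[OF \<theta>] by (simp add: \<theta>_def)
qed

section \<open>The image idempotent of a twisted bimodule isomorphic to A_g\<close>

text \<open>Twisting alters only the right action, so on the left the target is the plain
  ideal.\<close>

lemma twisted_imp_left_isomorphic:
  assumes "bimod_isomorphic R P (twisted_bimod R \<theta>)"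
  shows "left_isomorphic R P (sub_bimod A (PIdl\<^bsub>R\<^esub> (im_one \<theta>)))"
proof -
  have "left_hom R P (twisted_bimod R \<theta>) = left_hom R P (sub_bimod A (PIdl\<^bsub>R\<^esub> (im_one \<theta>)))"
    by (simp add: left_hom_def twisted_bimod_def sub_bimod_def principal_component_def)
  then show ?thesis
    using assms unfolding bimod_isomorphic_def left_isomorphic_def
    by (auto simp: twisted_bimod_def sub_bimod_def)
qed

text \<open>Each of the two idempotents absorbs the other. Transport of left multiplication by j
  along the isomorphism shows that j fixes A_g, hence \<open>eps g\<close>; conversely j is the
  image of some x fixed by \<open>eps g\<close>, so \<open>eps g\<close> fixes j. Centrality of j
  then identifies them.\<close>

lemma left_isomorphic_PIdl_unique:
  assumes g: "g \<in> carrier G" and j: "j \<in> central_idempotents R"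
    and iso: "left_isomorphic R (sub_bimod A (gr g)) (sub_bimod A (PIdl\<^bsub>R\<^esub> j))"
  shows "j = eps g"
proof -
  have j1: "j \<in> gr \<one>\<^bsub>G\<^esub>" "j \<otimes>\<^bsub>A\<^esub> j = j" "\<And>r. r \<in> gr \<one>\<^bsub>G\<^esub> \<Longrightarrow> j \<otimes>\<^bsub>A\<^esub> r = r \<otimes>\<^bsub>A\<^esub> j"
    using j by (auto simp: central_idempotents_def principal_component_def)
  note J = mem_PIdl_idempotent[OF j1(1,2)]
  obtain f where f: "f \<in> left_hom R (sub_bimod A (gr g)) (sub_bimod A (PIdl\<^bsub>R\<^esub> j))"
    and bij: "bij_betw f (gr g) (PIdl\<^bsub>R\<^esub> j)"
    using iso by (auto simp: left_isomorphic_def sub_bimod_def)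
  have lin: "f (r \<otimes>\<^bsub>A\<^esub> x) = r \<otimes>\<^bsub>A\<^esub> f x" if "r \<in> gr \<one>\<^bsub>G\<^esub>" "x \<in> gr g" for r x
    using left_homD(3)[OF f] that by (simp add: sub_bimod_def principal_component_def)
  have "j \<otimes>\<^bsub>A\<^esub> x = x" if x: "x \<in> gr g" for x
  proof -
    have "f x \<in> PIdl\<^bsub>R\<^esub> j" using bij_betwE[OF bij] x by auto
    then have "f (j \<otimes>\<^bsub>A\<^esub> x) = f x" using lin[OF j1(1) x] j1(3) by (simp add: J)
    then show ?thesis
      using bij gr_lsmult[OF g j1(1) x] x by (metis bij_betw_imp_inj_on inj_onD)
  qed
  then have "j \<otimes>\<^bsub>A\<^esub> eps g = eps g" using left_unit_epsilon[OF g] gr_one_carrier[OF j1(1)] by simp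
  moreover obtain x where x: "x \<in> gr g" "f x = j"
    using bij J[of j] j1 unfolding bij_betw_def by (metis imageE)
  have "eps g \<otimes>\<^bsub>A\<^esub> j = j"
    using lin[OF epsilon_gr_one[OF g] x(1)] epsilon_left[OF g x(1)] x(2) by simp
  ultimately show ?thesis using j1(3)[OF epsilon_gr_one[OF g]] by simp
qed

text \<open>Here the idempotents of \<theta> are not prescribed. Uniqueness identifies
  \<open>im_one\<close> with \<open>eps g\<close>, which reduces the claim to the left isomorphism
  already treated.\<close>

lemma twisted_imp_epsilon_invertible:
  assumes g: "g \<in> carrier G" and \<theta>: "\<theta> \<in> I_u R"
    and iso: "bimod_isomorphic R (sub_bimod A (gr g)) (twisted_bimod R \<theta>)"
  obtains s where "s \<in> gr g" "epsilon_invertible G A gr g s"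
proof -
  have l: "left_isomorphic R (sub_bimod A (gr g)) (sub_bimod A (PIdl\<^bsub>R\<^esub> (im_one \<theta>)))"
    by (rule twisted_imp_left_isomorphic[OF iso])
  have "im_one \<theta> = eps g"
    by (rule left_isomorphic_PIdl_unique[OF g _ l]) (use \<theta> in \<open>simp add: I_u_def\<close>)
  then show thesis using left_isomorphic_imp_epsilon_invertible[OF g] l that by metis
qed

section \<open>Epsilon-invertible elements as one-element generators of components\<close>

text \<open>By distributivity a sum of left multiples of \<kappa> is again a single multiple, so the
  span reduces to an image.\<close>

lemma ideal_prod_singleton_right:
  assumes \<kappa>: "\<kappa> \<in> carrier A"
  shows "gr \<one>\<^bsub>G\<^esub> \<cdot>\<^bsub>A\<^esub> {\<kappa>} = (\<lambda>r. r \<otimes>\<^bsub>A\<^esub> \<kappa>) ` gr \<one>\<^bsub>G\<^esub>"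
proof
  show "gr \<one>\<^bsub>G\<^esub> \<cdot>\<^bsub>A\<^esub> {\<kappa>} \<subseteq> (\<lambda>r. r \<otimes>\<^bsub>A\<^esub> \<kappa>) ` gr \<one>\<^bsub>G\<^esub>"
  proof
    fix z assume "z \<in> gr \<one>\<^bsub>G\<^esub> \<cdot>\<^bsub>A\<^esub> {\<kappa>}"
    then show "z \<in> (\<lambda>r. r \<otimes>\<^bsub>A\<^esub> \<kappa>) ` gr \<one>\<^bsub>G\<^esub>"
    proof induction
      case (sum z1 z2)
      then obtain r1 r2 where "r1 \<in> gr \<one>\<^bsub>G\<^esub>" "r2 \<in> gr \<one>\<^bsub>G\<^esub>" "z1 = r1 \<otimes>\<^bsub>A\<^esub> \<kappa>" "z2 = r2 \<otimes>\<^bsub>A\<^esub> \<kappa>" by blast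
      then show ?case using gr_add[of "\<one>\<^bsub>G\<^esub>" r1 r2] \<kappa> gr_one_carrier
        by (intro image_eqI[of _ _ "r1 \<oplus>\<^bsub>A\<^esub> r2"]) (simp_all add: A.l_distr)
    qed auto
  qed
qed (auto intro: ideal_prod.prod)

lemma ideal_prod_singleton_left:
  assumes \<kappa>: "\<kappa> \<in> carrier A"
  shows "{\<kappa>} \<cdot>\<^bsub>A\<^esub> gr \<one>\<^bsub>G\<^esub> = (\<lambda>r. \<kappa> \<otimes>\<^bsub>A\<^esub> r) ` gr \<one>\<^bsub>G\<^esub>"
proof
  show "{\<kappa>} \<cdot>\<^bsub>A\<^esub> gr \<one>\<^bsub>G\<^esub> \<subseteq> (\<lambda>r. \<kappa> \<otimes>\<^bsub>A\<^esub> r) ` gr \<one>\<^bsub>G\<^esub>"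
  proof
    fix z assume "z \<in> {\<kappa>} \<cdot>\<^bsub>A\<^esub> gr \<one>\<^bsub>G\<^esub>"
    then show "z \<in> (\<lambda>r. \<kappa> \<otimes>\<^bsub>A\<^esub> r) ` gr \<one>\<^bsub>G\<^esub>"
    proof induction
      case (sum z1 z2)
      then obtain r1 r2 where "r1 \<in> gr \<one>\<^bsub>G\<^esub>" "r2 \<in> gr \<one>\<^bsub>G\<^esub>" "z1 = \<kappa> \<otimes>\<^bsub>A\<^esub> r1" "z2 = \<kappa> \<otimes>\<^bsub>A\<^esub> r2" by blast
      then show ?case using gr_add[of "\<one>\<^bsub>G\<^esub>" r1 r2] \<kappa> gr_one_carrier
        by (intro image_eqI[of _ _ "r1 \<oplus>\<^bsub>A\<^esub> r2"]) (simp_all add: A.r_distr)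
    qed auto
  qed
qed (auto intro: ideal_prod.prod)

text \<open>For an inverse b of s, each x in A_g equals (xb)s and s(bx), with xb and bx in
  R.\<close>

lemma epsilon_invertible_generates:
  assumes g: "g \<in> carrier G" and inv: "epsilon_invertible G A gr g s"
  shows "gr \<one>\<^bsub>G\<^esub> \<cdot>\<^bsub>A\<^esub> {s} = gr g" "{s} \<cdot>\<^bsub>A\<^esub> gr \<one>\<^bsub>G\<^esub> = gr g"
    "gr g \<noteq> {\<zero>\<^bsub>A\<^esub>} \<Longrightarrow> s \<in> nonzero_homogeneous G A gr"
proof -
  let ?h = "inv\<^bsub>G\<^esub> g"
  have h: "?h \<in> carrier G" using g by simp
  obtain b where s: "s \<in> gr g" and b: "b \<in> gr ?h" and sb: "s \<otimes>\<^bsub>A\<^esub> b = eps g" and bs: "b \<otimes>\<^bsub>A\<^esub> s = eps ?h"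
    using inv unfolding epsilon_invertible_def by blast
  note c = gr_carrier[OF g s] gr_carrier[OF h b]
  have "x = (x \<otimes>\<^bsub>A\<^esub> b) \<otimes>\<^bsub>A\<^esub> s" if x: "x \<in> gr g" for x
    using epsilon_right[OF g x] gr_carrier[OF g x] c bs by (simp add: A.m_assoc)
  then show "gr \<one>\<^bsub>G\<^esub> \<cdot>\<^bsub>A\<^esub> {s} = gr g"
    unfolding ideal_prod_singleton_right[OF c(1)]
    using gr_mult_inv(1)[OF g _ b] gr_lsmult[OF g _ s] by blast
  have x: "x = s \<otimes>\<^bsub>A\<^esub> (b \<otimes>\<^bsub>A\<^esub> x)" if x: "x \<in> gr g" for x
    using epsilon_left[OF g x] gr_carrier[OF g x] c sb by (simp flip: A.m_assoc)
  then show "{s} \<cdot>\<^bsub>A\<^esub> gr \<one>\<^bsub>G\<^esub> = gr g"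
    unfolding ideal_prod_singleton_left[OF c(1)]
    using gr_mult_inv(2)[OF g _ b] gr_rsmult[OF g _ s] by blast
  show "s \<in> nonzero_homogeneous G A gr" if ne: "gr g \<noteq> {\<zero>\<^bsub>A\<^esub>}"
  proof -
    have "s \<noteq> \<zero>\<^bsub>A\<^esub>"
    proof
      assume 0: "s = \<zero>\<^bsub>A\<^esub>"
      \<comment> \<open>From y = s(by), vanishing of s forces the whole component to vanish.\<close>
      have "y = \<zero>\<^bsub>A\<^esub>" if y: "y \<in> gr g" for y
        using x[OF y] gr_carrier[OF g y] c(2) by (simp add: 0)
      then show False using ne gr_zero[OF g] by blast
    qed
    then show ?thesis using s g by (auto simp: nonzero_homogeneous_def)
  qed
qed

text \<open>Writing a in A_g as \<kappa> r turns ab into \<kappa>(rb), so every element of A_g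
  A_(g^-1), in particular \<open>eps g\<close>, is \<kappa> times an element of A_(g^-1). The
  mirrored argument gives a left inverse, and the two one-sided inverses agree.\<close>

lemma generator_imp_epsilon_invertible:
  assumes g: "g \<in> carrier G" and \<kappa>: "\<kappa> \<in> gr g"
    and gen: "gr \<one>\<^bsub>G\<^esub> \<cdot>\<^bsub>A\<^esub> {\<kappa>} = gr g" "{\<kappa>} \<cdot>\<^bsub>A\<^esub> gr \<one>\<^bsub>G\<^esub> = gr g"
  shows "epsilon_invertible G A gr g \<kappa>"
proof -
  let ?h = "inv\<^bsub>G\<^esub> g"
  have h: "?h \<in> carrier G" using g by simp
  note c = gr_carrier[OF g \<kappa>]
  note gen' = gen[unfolded ideal_prod_singleton_right[OF c] ideal_prod_singleton_left[OF c]]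
  have "\<exists>u\<in>gr ?h. z = \<kappa> \<otimes>\<^bsub>A\<^esub> u" if "z \<in> gr g \<cdot>\<^bsub>A\<^esub> gr ?h" for z
    using that
  proof induction
    case (prod a b)
    then obtain r where r: "r \<in> gr \<one>\<^bsub>G\<^esub>" "a = \<kappa> \<otimes>\<^bsub>A\<^esub> r" using gen' by blast
    then show ?case using gr_lsmult[OF h r(1) prod(2)] c gr_one_carrier gr_carrier[OF h prod(2)]
      by (auto simp: A.m_assoc)
  next
    case (sum z1 z2)
    then obtain u v where uv: "u \<in> gr ?h" "v \<in> gr ?h" "z1 = \<kappa> \<otimes>\<^bsub>A\<^esub> u" "z2 = \<kappa> \<otimes>\<^bsub>A\<^esub> v" by blast
    then have "z1 \<oplus>\<^bsub>A\<^esub> z2 = \<kappa> \<otimes>\<^bsub>A\<^esub> (u \<oplus>\<^bsub>A\<^esub> v)" using c gr_carrier[OF h] by (simp add: A.r_distr)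
    then show ?case using gr_add[OF h uv(1,2)] by blast
  qed
  then obtain u where u: "u \<in> gr ?h" "\<kappa> \<otimes>\<^bsub>A\<^esub> u = eps g" using epsilon_prod[OF g] by metis
  have "\<exists>v\<in>gr ?h. z = v \<otimes>\<^bsub>A\<^esub> \<kappa>" if "z \<in> gr ?h \<cdot>\<^bsub>A\<^esub> gr g" for z
    using that
  proof induction
    case (prod b a)
    then obtain r where r: "r \<in> gr \<one>\<^bsub>G\<^esub>" "a = r \<otimes>\<^bsub>A\<^esub> \<kappa>" using gen' by blast
    have "b \<otimes>\<^bsub>A\<^esub> a = (b \<otimes>\<^bsub>A\<^esub> r) \<otimes>\<^bsub>A\<^esub> \<kappa>"
      using r c gr_one_carrier gr_carrier[OF h prod(1)] by (simp add: A.m_assoc)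
    then show ?case using gr_rsmult[OF h r(1) prod(1)] by blast
  next
    case (sum z1 z2)
    then obtain u v where uv: "u \<in> gr ?h" "v \<in> gr ?h" "z1 = u \<otimes>\<^bsub>A\<^esub> \<kappa>" "z2 = v \<otimes>\<^bsub>A\<^esub> \<kappa>" by blast
    then have "z1 \<oplus>\<^bsub>A\<^esub> z2 = (u \<oplus>\<^bsub>A\<^esub> v) \<otimes>\<^bsub>A\<^esub> \<kappa>" using c gr_carrier[OF h] by (simp add: A.l_distr)
    then show ?case using gr_add[OF h uv(1,2)] by blast
  qed
  then obtain v where v: "v \<in> gr ?h" "v \<otimes>\<^bsub>A\<^esub> \<kappa> = eps ?h" using epsilon_inv_prod[OF g] by metis
  show ?thesis by (rule epsilon_invertibleI[OF g \<kappa> u(1) v(1) u(2) v(2)])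
qed

section \<open>The equivalences for a single component\<close>

lemma epsilon_invertible_iff_left_isomorphic:
  assumes g: "g \<in> carrier G"
  shows "(\<exists>s\<in>gr g. epsilon_invertible G A gr g s) \<longleftrightarrow>
    left_isomorphic R (sub_bimod A (gr g)) (sub_bimod A (PIdl\<^bsub>R\<^esub> (eps g)))"
proof
  assume "\<exists>s\<in>gr g. epsilon_invertible G A gr g s"
  then obtain \<theta> where "im_one \<theta> = eps g"
    "bimod_isomorphic R (sub_bimod A (gr g)) (twisted_bimod R \<theta>)"
    using epsilon_invertible_imp_bimod_isomorphic[OF g] by blast
  \<comment> \<open>The left isomorphism is obtained from the twisted bimodule by forgetting the
    right action.\<close>
  then show "left_isomorphic R (sub_bimod A (gr g)) (sub_bimod A (PIdl\<^bsub>R\<^esub> (eps g)))"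
    using twisted_imp_left_isomorphic[of "sub_bimod A (gr g)" \<theta>] by simp
qed (use left_isomorphic_imp_epsilon_invertible[OF g] in blast)

lemma left_isomorphic_iff_twisted:
  assumes g: "g \<in> carrier G"
  shows "left_isomorphic R (sub_bimod A (gr g)) (sub_bimod A (PIdl\<^bsub>R\<^esub> (eps g))) \<longleftrightarrow>
    (\<exists>\<theta>\<in>I_u R. dom_one \<theta> = eps (inv\<^bsub>G\<^esub> g) \<and> im_one \<theta> = eps g \<and>
      bimod_isomorphic R (sub_bimod A (gr g)) (twisted_bimod R \<theta>))"
  unfolding epsilon_invertible_iff_left_isomorphic[OF g, symmetric]
proof
  assume "\<exists>s\<in>gr g. epsilon_invertible G A gr g s"
  then show "\<exists>\<theta>\<in>I_u R. dom_one \<theta> = eps (inv\<^bsub>G\<^esub> g) \<and> im_one \<theta> = eps g \<and>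
      bimod_isomorphic R (sub_bimod A (gr g)) (twisted_bimod R \<theta>)"
    using epsilon_invertible_imp_bimod_isomorphic[OF g] by metis
qed (use twisted_imp_epsilon_invertible[OF g] in blast)

text \<open>The variant with unrestricted idempotents of \<theta>, the form in which
  \<open>omega\<close> and \<nu> enter the global statements.\<close>

lemma epsilon_invertible_iff_twisted:
  assumes g: "g \<in> carrier G"
  shows "(\<exists>s\<in>gr g. epsilon_invertible G A gr g s) \<longleftrightarrow>
    (\<exists>\<theta>\<in>I_u R. bimod_isomorphic R (sub_bimod A (gr g)) (twisted_bimod R \<theta>))"
  using epsilon_invertible_imp_bimod_isomorphic[OF g] twisted_imp_epsilon_invertible[OF g] by blast

section \<open>The equivalences for the whole grading\<close>

lemma crossed_product_iff_generators:
  "epsilon_crossed_product G A gr \<longleftrightarrow>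
    (\<exists>\<kappa>. \<forall>g \<in> carrier G. \<kappa> g \<in> gr g \<and>
      (gr g \<noteq> {\<zero>\<^bsub>A\<^esub>} \<longrightarrow> \<kappa> g \<in> nonzero_homogeneous G A gr) \<and>
      carrier R \<cdot>\<^bsub>A\<^esub> {\<kappa> g} = gr g \<and> gr g = {\<kappa> g} \<cdot>\<^bsub>A\<^esub> carrier R)"
proof -
  have R: "carrier R = gr \<one>\<^bsub>G\<^esub>" by (simp add: principal_component_def)
  \<comment> \<open>The two conditions are equivalent for one and the same s, so \<kappa> is just a
    choice of an epsilon-invertible element in each component.\<close>
  have "s \<in> gr g \<and> epsilon_invertible G A gr g s \<longleftrightarrow> s \<in> gr g \<and>
      (gr g \<noteq> {\<zero>\<^bsub>A\<^esub>} \<longrightarrow> s \<in> nonzero_homogeneous G A gr) \<and>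
      carrier R \<cdot>\<^bsub>A\<^esub> {s} = gr g \<and> gr g = {s} \<cdot>\<^bsub>A\<^esub> carrier R" if g: "g \<in> carrier G" for g s
    unfolding R
    using epsilon_invertible_generates[OF g, of s] generator_imp_epsilon_invertible[OF g, of s] by metis
  then show ?thesis
    unfolding epsilon_crossed_product_def bchoice_iff Bex_def by (simp cong: ball_cong)
qed

text \<open>Translates equality of isomorphism classes into isomorphism of representatives, although
  neither representative has the type of the members of a class.\<close>

lemma bimod_class_eq_omega_iff:
  assumes g: "g \<in> carrier G" and \<theta>: "\<theta> \<in> I_u R"
  shows "bimod_class R (sub_bimod A (gr g)) = omega R \<theta> \<longleftrightarrow>
    bimod_isomorphic R (sub_bimod A (gr g)) (twisted_bimod R \<theta>)"
proof
  have T: "bimodule R (twisted_bimod R \<theta>)"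
    using twisted_partially_invertible[OF ring_principal_component \<theta>]
    by (simp add: partially_invertible_def)
  assume "bimod_class R (sub_bimod A (gr g)) = omega R \<theta>"
  \<comment> \<open>Members of a class are carried by functions on \<open>nat\<close>, so the
    constant-function copy of the twisted bimodule serves as the witness and is afterwards undone by
    symmetry and transitivity.\<close>
  moreover have "const_copy (twisted_bimod R \<theta>) \<in> omega R \<theta>"
    using const_copy[OF T] by (simp add: omega_def bimod_class_def)
  ultimately have "bimod_isomorphic R (sub_bimod A (gr g)) (const_copy (twisted_bimod R \<theta>))"
    by (auto simp: bimod_class_def)
  then show "bimod_isomorphic R (sub_bimod A (gr g)) (twisted_bimod R \<theta>)"
    using bimod_isomorphic_sym[OF T const_copy(2)[OF T]] by (rule bimod_isomorphic_trans)
qed (unfold omega_def, rule bimod_class_eq[OF gr_bimodule[OF g]])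

lemma crossed_product_iff_Comp:
  "epsilon_crossed_product G A gr \<longleftrightarrow> Comp G A gr \<subseteq> omega R ` I_u R"
proof -
  have "Comp G A gr \<subseteq> omega R ` I_u R \<longleftrightarrow>
    (\<forall>g\<in>carrier G. \<exists>\<theta>\<in>I_u R. bimod_class R (sub_bimod A (gr g)) = omega R \<theta>)"
    unfolding Comp_def by blast
  then show ?thesis
    by (simp add: epsilon_crossed_product_def epsilon_invertible_iff_twisted bimod_class_eq_omega_iff)
qed

lemma crossed_product_iff_twisted:
  "epsilon_crossed_product G A gr \<longleftrightarrow>
    (\<exists>\<nu> \<in> carrier G \<rightarrow> I_u R. \<forall>g \<in> carrier G.
      bimod_isomorphic R (sub_bimod A (gr g)) (twisted_bimod R (\<nu> g)))"
proof -
  have "epsilon_crossed_product G A gr \<longleftrightarrow> (\<forall>g \<in> carrier G. \<exists>\<theta>. \<theta> \<in> I_u R \<and>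
      bimod_isomorphic R (sub_bimod A (gr g)) (twisted_bimod R \<theta>))"
    using epsilon_invertible_iff_twisted unfolding epsilon_crossed_product_def Bex_def by simp
  also have "\<dots> \<longleftrightarrow> (\<exists>\<nu>. \<forall>g \<in> carrier G. \<nu> g \<in> I_u R \<and>
      bimod_isomorphic R (sub_bimod A (gr g)) (twisted_bimod R (\<nu> g)))"
    by (rule bchoice_iff)
  finally show ?thesis by (simp add: Pi_iff Bex_def ball_conj_distrib)
qed

end

theorem lemma4p1:
  fixes G :: "('g, 'm) monoid_scheme"
    and A R :: "('a, 'n) ring_scheme"
    and gr :: "'g \<Rightarrow> 'a set"
    and \<epsilon> :: "'g \<Rightarrow> 'a"
  assumes graded: "epsilon_strongly_graded_ring G A gr"
    and \<epsilon>: "\<epsilon> = epsilon G A gr"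
    and R: "R = principal_component G A gr"
  shows
    "(\<forall>g \<in> carrier G. \<forall>s \<in> gr g. \<forall>u \<in> gr (inv\<^bsub>G\<^esub> g). \<forall>v \<in> gr (inv\<^bsub>G\<^esub> g).
        s \<otimes>\<^bsub>A\<^esub> u = \<epsilon> g \<and> v \<otimes>\<^bsub>A\<^esub> s = \<epsilon> (inv\<^bsub>G\<^esub> g) \<longrightarrow>
        u = v \<and> epsilon_invertible G A gr g s) \<and>
     (\<forall>g \<in> carrier G.
        ((\<exists>s \<in> gr g. epsilon_invertible G A gr g s) \<longleftrightarrow>
           left_isomorphic R (sub_bimod A (gr g)) (sub_bimod A (PIdl\<^bsub>R\<^esub> (\<epsilon> g)))) \<and>
        (left_isomorphic R (sub_bimod A (gr g)) (sub_bimod A (PIdl\<^bsub>R\<^esub> (\<epsilon> g))) \<longleftrightarrow>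
           (\<exists>\<theta> \<in> I_u R. dom_one \<theta> = \<epsilon> (inv\<^bsub>G\<^esub> g) \<and> im_one \<theta> = \<epsilon> g \<and>
              bimod_isomorphic R (sub_bimod A (gr g)) (twisted_bimod R \<theta>)))) \<and>
     (epsilon_crossed_product G A gr \<longleftrightarrow>
        (\<exists>\<kappa> :: 'g \<Rightarrow> 'a. \<forall>g \<in> carrier G. \<kappa> g \<in> gr g \<and>
           (gr g \<noteq> {\<zero>\<^bsub>A\<^esub>} \<longrightarrow> \<kappa> g \<in> nonzero_homogeneous G A gr) \<and>
           carrier R \<cdot>\<^bsub>A\<^esub> {\<kappa> g} = gr g \<and> gr g = {\<kappa> g} \<cdot>\<^bsub>A\<^esub> carrier R)) \<and>
     (epsilon_crossed_product G A gr \<longleftrightarrow> Comp G A gr \<subseteq> omega R ` I_u R) \<and>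
     (epsilon_crossed_product G A gr \<longleftrightarrow>
        (\<exists>\<nu> \<in> carrier G \<rightarrow> I_u R. \<forall>g \<in> carrier G.
           bimod_isomorphic R (sub_bimod A (gr g)) (twisted_bimod R (\<nu> g))))"
proof -
  interpret epsilon_strongly_graded_ring G A gr by (rule graded)
  show ?thesis
    unfolding \<epsilon> R
  proof (intro conjI crossed_product_iff_generators crossed_product_iff_Comp crossed_product_iff_twisted)
    show "\<forall>g \<in> carrier G. \<forall>s \<in> gr g. \<forall>u \<in> gr (inv\<^bsub>G\<^esub> g). \<forall>v \<in> gr (inv\<^bsub>G\<^esub> g).
        s \<otimes>\<^bsub>A\<^esub> u = eps g \<and> v \<otimes>\<^bsub>A\<^esub> s = eps (inv\<^bsub>G\<^esub> g) \<longrightarrow>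
        u = v \<and> epsilon_invertible G A gr g s"
    proof (intro ballI impI)
      fix g s u v
      assume "g \<in> carrier G" "s \<in> gr g" "u \<in> gr (inv\<^bsub>G\<^esub> g)" "v \<in> gr (inv\<^bsub>G\<^esub> g)"
        "s \<otimes>\<^bsub>A\<^esub> u = eps g \<and> v \<otimes>\<^bsub>A\<^esub> s = eps (inv\<^bsub>G\<^esub> g)"
      then show "u = v \<and> epsilon_invertible G A gr g s"
        using one_sided_inverses_eq[of g s u v] epsilon_invertibleI[of g s u v] by simp
    qed
  qed (intro ballI conjI epsilon_invertible_iff_left_isomorphic left_isomorphic_iff_twisted)
qed

end
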